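(* Let $0<q<1$, $n\ge1$, $L\ge1$. For $n$-species configurations $\boldsymbol\xi=(\xi_i^x)$ and $\boldsymbol\eta=(\eta_i^x)$, $1\le x\le L$, $0\le i\le n-1$, with entries in $\mathbb Z_{\ge0}$, set $$h(\boldsymbol\xi,\boldsymbol\eta)=\sum_{x=1}^L\sum_{i=0}^{n-1}\Big(-\xi_i^xN^+_{x+1}(\boldsymbol\eta_{[0,n-2-i]})+\eta_i^xN^+_x(\boldsymbol\xi_{[0,n-2-i]})\Big),$$ $$D(\boldsymbol\xi,\boldsymbol\eta)=q^{h(\boldsymbol\xi,\boldsymbol\eta)}\prod_{i=0}^{n-1}\prod_{x=1}^L\Big(q^{-2(N^-_{x}(\boldsymbol\xi_i)+N^+_{x+1}(\boldsymbol\eta_{n-1-i}))+1};q^2\Big)_{\xi_i^x}.$$ Then the $n$-species $q^2$-Hahn TAZRP, both in discrete time and in continuous time, is dual to its space reversal with respect to $D$: if $\boldsymbol\xi(t)$ evolves with total asymmetry to the right and $\boldsymbol\eta(t)$ evolves with total asymmetry to the left (with the same parameters), then $\mathbb E_{\boldsymbol\xi}[D(\boldsymbol\xi(t),\boldsymbol\eta)]=\mathbb E_{\boldsymbol\eta}[D(\boldsymbol\xi,\boldsymbol\eta(t))]$ for all times $t$ and all $\boldsymbol\xi,\boldsymbol\eta$.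
   Context: Notation: $\boldsymbol\xi_i=(\xi_i^1,\dots,\xi_i^L)$, $\boldsymbol\xi^x=(\xi^x_0,\dots,\xi^x_{n-1})$; $\boldsymbol\xi_{[a,b]}=\sum_{j=a}^b\boldsymbol\xi_j$ (zero if $b<a$); for a vector $\boldsymbol v$, $N_x^-(\boldsymbol v)=\sum_{1\le y\le x}v^y$, $N_x^+(\boldsymbol v)=\sum_{x\le y\le L}v^y$; $(a;Q)_k=\prod_{j=0}^{k-1}(1-aQ^j)$. For $Q\in(0,1)$ and $\boldsymbol\gamma,\boldsymbol\beta\in\mathbb Z_{\ge0}^n$ with $\gamma_i\le\beta_i$ for all $i$, let $$\Phi_Q(\boldsymbol\gamma\mid\boldsymbol\beta;\lambda,\mu)=Q^{\sum_{0\le i<j\le n-1}(\beta_i-\gamma_i)\gamma_j}\Big(\frac\mu\lambda\Big)^{|\boldsymbol\gamma|}\frac{(\lambda;Q)_{|\boldsymbol\gamma|}(\mu/\lambda;Q)_{|\boldsymbol\beta|-|\boldsymbol\gamma|}}{(\mu;Q)_{|\boldsymbol\beta|}}\prod_{i=0}^{n-1}\frac{(Q;Q)_{\beta_i}}{(Q;Q)_{\gamma_i}(Q;Q)_{\beta_i-\gamma_i}},\qquad|\boldsymbol\gamma|=\sum_i\gamma_i,$$ where $0\le\mu\le\lambda\le1$, $\lambda>0$, $\mu<1$; it is a probability distribution in $\boldsymbol\gamma$. The $Q$-Hahn TAZRP on $\{1,\dots,L\}$ with closed boundary (used with $Q=q^2$): Discrete time, asymmetry to the right: at each step, independently for $x=1,\dots,L-1$,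 a vector $\boldsymbol\gamma^x\le\boldsymbol\xi^x$ of particles is drawn with probability $\Phi_Q(\boldsymbol\gamma^x\mid\boldsymbol\xi^x;\lambda,\mu)$ and all these particles move simultaneously from $x$ to $x+1$; the new configuration is $\boldsymbol\xi^x-\boldsymbol\gamma^x+\boldsymbol\gamma^{x-1}$ with $\boldsymbol\gamma^0=\boldsymbol\gamma^L=0$. Asymmetry to the left: independently for $x=2,\dots,L$, $\boldsymbol\gamma^x$ is drawn with probability $\Phi_Q(\boldsymbol\gamma^x\mid\boldsymbol\eta^x;\lambda,\mu)$ and moves from $x$ to $x-1$; the new configuration is $\boldsymbol\eta^x-\boldsymbol\gamma^x+\boldsymbol\gamma^{x+1}$ with $\boldsymbol\gamma^1=\boldsymbol\gamma^{L+1}=0$. Continuous time ($0\le\mu<1$): for each $1\le x\le L-1$ and each $0\ne\boldsymbol\gamma\le\boldsymbol\xi^x$, the particles $\boldsymbol\gamma$ jump from $x$ to $x+1$ (asymmetry to the right) at rate $-\frac{\partial}{\partial\lambda}\Phi_Q(\boldsymbol\gamma\mid\boldsymbol\xi^x;\lambda,\mu)\big|_{\lambda=1}\ge0$; for asymmetry to the left, particles $\boldsymbol\gamma\le\boldsymbol\eta^x$ jump from $x$ to $x-1$, $2\le x\le L$, at rate $-\frac{\partial}{\partial\lambda}\Phi_Q(\boldsymbol\gamma\mid\boldsymbol\eta^x;\lambda,\mu)\big|_{\lambda=1}$. *)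

theory Defs
  imports "HOL-Probability.Probability"
begin

section \<open>The weights \<open>\<Phi>\<^sub>Q\<close>\<close>

definition qpoch :: "real \<Rightarrow> real \<Rightarrow> nat \<Rightarrow> real" where
  "qpoch a Q k = (\<Prod>j<k. 1 - a * Q ^ j)"

definition vsum :: "nat \<Rightarrow> (nat \<Rightarrow> nat) \<Rightarrow> nat" where
  "vsum n v = (\<Sum>i<n. v i)"

text \<open>Only meaningful for \<open>\<gamma> \<le> \<beta>\<close>, where the natural-number subtractions are exact.
  It is a function of all real \<open>l\<close>, so that it can be differentiated at \<open>l = 1\<close>.\<close>

definition Phi :: "nat \<Rightarrow> real \<Rightarrow> (nat \<Rightarrow> nat) \<Rightarrow> (nat \<Rightarrow> nat) \<Rightarrow> real \<Rightarrow> real \<Rightarrow> real" where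
  "Phi n Q \<gamma> \<beta> l m =
     Q ^ (\<Sum>j<n. \<Sum>i<j. (\<beta> i - \<gamma> i) * \<gamma> j) * (m / l) ^ vsum n \<gamma>
     * (qpoch l Q (vsum n \<gamma>) * qpoch (m / l) Q (vsum n \<beta> - vsum n \<gamma>) / qpoch m Q (vsum n \<beta>))
     * (\<Prod>i<n. qpoch Q Q (\<beta> i) / (qpoch Q Q (\<gamma> i) * qpoch Q Q (\<beta> i - \<gamma> i)))"

text \<open>The order on vectors is pointwise. If \<open>\<beta>\<close> vanishes outside \<open>{..<n}\<close>,
  then so does every \<open>\<gamma> \<le> \<beta>\<close>.\<close>

definition Phi_pmf :: "nat \<Rightarrow> real \<Rightarrow> real \<Rightarrow> real \<Rightarrow> (nat \<Rightarrow> nat) \<Rightarrow> (nat \<Rightarrow> nat) pmf" where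
  "Phi_pmf n Q l m \<beta> = embed_pmf (\<lambda>\<gamma>. if \<gamma> \<le> \<beta> then Phi n Q \<gamma> \<beta> l m else 0)"

section \<open>Configurations and jumps\<close>

text \<open>\<open>\<xi> x i\<close> is the number of particles of species \<open>i\<close> at site \<open>x\<close>;
  it is required to vanish outside \<open>1 \<le> x \<le> L\<close>, \<open>i < n\<close>.\<close>

type_synonym config = "nat \<Rightarrow> nat \<Rightarrow> nat"

definition configs :: "nat \<Rightarrow> nat \<Rightarrow> config set" where
  "configs n L = {\<xi>. \<forall>x i. \<xi> x i \<noteq> 0 \<longrightarrow> x \<in> {1..L} \<and> i < n}"

text \<open>\<open>\<gamma> x\<close> is the vector of particles leaving site \<open>x\<close>. For \<open>x = 0\<close> the truncated
  \<open>x - 1\<close> is harmless, since \<open>\<gamma> 0 = 0\<close> in all uses.\<close>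

definition move_right :: "config \<Rightarrow> config \<Rightarrow> config" where
  "move_right \<xi> \<gamma> = (\<lambda>x i. \<xi> x i - \<gamma> x i + \<gamma> (x - 1) i)"

definition move_left :: "config \<Rightarrow> config \<Rightarrow> config" where
  "move_left \<eta> \<gamma> = (\<lambda>x i. \<eta> x i - \<gamma> x i + \<gamma> (x + 1) i)"

section \<open>Discrete time\<close>

text \<open>\<open>Pi_pmf\<close> makes the \<open>\<gamma> x\<close> independent and sets \<open>\<gamma> x = 0\<close> at the remaining sites.\<close>

definition step_right :: "nat \<Rightarrow> nat \<Rightarrow> real \<Rightarrow> real \<Rightarrow> real \<Rightarrow> config \<Rightarrow> config pmf" where
  "step_right n L Q l m \<xi> =
     map_pmf (move_right \<xi>) (Pi_pmf {1..<L} (\<lambda>_. 0) (\<lambda>x. Phi_pmf n Q l m (\<xi> x)))"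

definition step_left :: "nat \<Rightarrow> nat \<Rightarrow> real \<Rightarrow> real \<Rightarrow> real \<Rightarrow> config \<Rightarrow> config pmf" where
  "step_left n L Q l m \<eta> =
     map_pmf (move_left \<eta>) (Pi_pmf {2..L} (\<lambda>_. 0) (\<lambda>x. Phi_pmf n Q l m (\<eta> x)))"

text \<open>Law at time \<open>t\<close> of the Markov chain with one-step kernel \<open>K\<close>, started from \<open>s\<close>.\<close>

primrec chain_law :: "('s \<Rightarrow> 's pmf) \<Rightarrow> nat \<Rightarrow> 's \<Rightarrow> 's pmf" where
  "chain_law K 0 s = return_pmf s"
| "chain_law K (Suc t) s = bind_pmf (chain_law K t s) K"

section \<open>Continuous time\<close>

definition jump_rate :: "nat \<Rightarrow> real \<Rightarrow> real \<Rightarrow> (nat \<Rightarrow> nat) \<Rightarrow> (nat \<Rightarrow> nat) \<Rightarrow> real" where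
  "jump_rate n Q m \<gamma> \<beta> = - deriv (\<lambda>l. Phi n Q \<gamma> \<beta> l m) 1"

text \<open>Total rate of the jumps leading from \<open>\<xi>\<close> to \<open>\<zeta>\<close>: in a jump, a nonzero vector \<open>g\<close>
  of particles leaves a single site \<open>x\<close>.\<close>

definition rate_right :: "nat \<Rightarrow> nat \<Rightarrow> real \<Rightarrow> real \<Rightarrow> config \<Rightarrow> config \<Rightarrow> real" where
  "rate_right n L Q m \<xi> \<zeta> =
     (\<Sum>(x, g) \<in> {(x, g). x \<in> {1..<L} \<and> g \<le> \<xi> x \<and> g \<noteq> (\<lambda>_. 0) \<and>
                      \<zeta> = move_right \<xi> ((\<lambda>_ _. 0)(x := g))}. jump_rate n Q m g (\<xi> x))"

definition rate_left :: "nat \<Rightarrow> nat \<Rightarrow> real \<Rightarrow> real \<Rightarrow> config \<Rightarrow> config \<Rightarrow> real" where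
  "rate_left n L Q m \<eta> \<zeta> =
     (\<Sum>(x, g) \<in> {(x, g). x \<in> {2..L} \<and> g \<le> \<eta> x \<and> g \<noteq> (\<lambda>_. 0) \<and>
                      \<zeta> = move_left \<eta> ((\<lambda>_ _. 0)(x := g))}. jump_rate n Q m g (\<eta> x))"

definition generator :: "'s set \<Rightarrow> ('s \<Rightarrow> 's \<Rightarrow> real) \<Rightarrow> 's \<Rightarrow> 's \<Rightarrow> real" where
  "generator S r s s' = (if s' = s then - (\<Sum>\<^sub>\<infinity>u\<in>S - {s}. r s u) else r s s')"

text \<open>\<open>P t s\<close> is the law at time \<open>t\<close> of a time-homogeneous continuous-time Markov chain on
  the state space \<open>S\<close>, started from \<open>s\<close>, whose jump rate from \<open>s\<close> to \<open>u \<noteq> s\<close> is \<open>r s u\<close>: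
  the \<open>P t\<close> form a Markov semigroup (Chapman--Kolmogorov), and
  \<open>P h s u = \<delta> s u + h * generator S r s u + o(h)\<close> as \<open>h\<close> decreases to \<open>0\<close>.
  For the processes considered here, only finitely many states are reachable from each
  state, so these conditions determine \<open>P t s\<close> for \<open>t \<ge> 0\<close>, \<open>s \<in> S\<close>.\<close>

definition markov_jump_law ::
    "'s set \<Rightarrow> ('s \<Rightarrow> 's \<Rightarrow> real) \<Rightarrow> (real \<Rightarrow> 's \<Rightarrow> 's pmf) \<Rightarrow> bool" where
  "markov_jump_law S r P \<longleftrightarrow>
     (\<forall>s\<in>S. P 0 s = return_pmf s) \<and>
     (\<forall>s\<in>S. \<forall>t\<ge>0. set_pmf (P t s) \<subseteq> S) \<and>
     (\<forall>s\<in>S. \<forall>t\<ge>0. \<forall>u\<ge>0. P (t + u) s = bind_pmf (P t s) (P u)) \<and>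
     (\<forall>s\<in>S. \<forall>s'\<in>S. ((\<lambda>t. pmf (P t s) s') has_real_derivative generator S r s s') (at_right 0))"

section \<open>The duality function\<close>

definition Nminus :: "nat \<Rightarrow> (nat \<Rightarrow> nat) \<Rightarrow> nat" where
  "Nminus x v = (\<Sum>y\<in>{1..x}. v y)"

definition Nplus :: "nat \<Rightarrow> nat \<Rightarrow> (nat \<Rightarrow> nat) \<Rightarrow> nat" where
  "Nplus L x v = (\<Sum>y\<in>{x..L}. v y)"

text \<open>\<open>species_below k \<xi>\<close> is \<open>\<xi>\<^bsub>[0,k-1]\<^esub>\<close>, which is zero for \<open>k = 0\<close>. The half-open form
  makes \<open>\<xi>\<^bsub>[0,n-2-i]\<^esub> = species_below (n - 1 - i) \<xi>\<close> correct for \<open>i = n - 1\<close> as well.\<close>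

definition species_below :: "nat \<Rightarrow> config \<Rightarrow> nat \<Rightarrow> nat" where
  "species_below k \<xi> = (\<lambda>x. \<Sum>j<k. \<xi> x j)"

definition hexp :: "nat \<Rightarrow> nat \<Rightarrow> config \<Rightarrow> config \<Rightarrow> int" where
  "hexp n L \<xi> \<eta> = (\<Sum>x\<in>{1..L}. \<Sum>i<n.
      - int (\<xi> x i) * int (Nplus L (x + 1) (species_below (n - 1 - i) \<eta>))
      + int (\<eta> x i) * int (Nplus L x (species_below (n - 1 - i) \<xi>)))"

definition Dual :: "nat \<Rightarrow> nat \<Rightarrow> real \<Rightarrow> config \<Rightarrow> config \<Rightarrow> real" where
  "Dual n L q \<xi> \<eta> = q powi hexp n L \<xi> \<eta> *
     (\<Prod>i<n. \<Prod>x\<in>{1..L}.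
        qpoch (q powi (- 2 * int (Nminus x (\<lambda>y. \<xi> y i) + Nplus L (x + 1) (\<lambda>y. \<eta> y (n - 1 - i))) + 1))
              (q\<^sup>2) (\<xi> x i))"

end

theory Submission
  imports Defs
begin

text \<open>Moving particles across the bond between \<open>x\<close> and \<open>x + 1\<close> multiplies \<open>Dual\<close> by a factor \<open>bond\<close>
  that depends, besides quantities fixed during the step, only on the vector \<open>\<gamma>\<close> jumping right
  from \<open>x\<close> and on the occupation of the second configuration at \<open>x + 1\<close>; a jump to the left of
  the second configuration produces the same function with the two arguments in exchanged roles.
  Hence it suffices that averaging \<open>bond\<close> against \<open>\<Phi>\<close> in either variable gives the same result.

  The averaging operator of \<open>\<Phi>\<close> is diagonal in a triangular basis \<open>f\<^sub>k\<close> of \<open>q\<close>-factorial functions,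
  with an eigenvalue depending only on \<open>\<bar>k\<bar>\<close>. In the same basis a first order
  \<open>Q\<close>-difference operator is diagonal with the pairwise distinct eigenvalues \<open>Q\<^bsup>-\<bar>k\<bar>\<^esup>\<close>. So
  averaging is a function of the difference operator, and for the latter the symmetry of
  \<open>bond\<close> is an explicit identity. Continuous time follows by differentiating at \<open>\<lambda> = 1\<close>.\<close>

section \<open>Sums of the weights over boxes\<close>

text \<open>The basis comes from a shift property: multiplying \<open>Phi\<close> by
  \<open>efun\<close> with index \<open>k\<close> and shifting both vectors by \<open>k\<close>
  reproduces \<open>Phi\<close> with \<open>l\<close> and \<open>m\<close> both scaled by
  \<open>Q ^ vsum n k\<close>, so the eigenvalue is read off from the normalisation of the scaled
  weights. The detour through \<open>qdiff\<close> is forced: the eigenvalues of averaging may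
  coincide (for \<open>m = 0\<close> or \<open>l = 1\<close> all but the one for
  \<open>k = 0\<close> vanish), so they need not separate the levels of the basis. Those of
  \<open>qdiff\<close> always do, and they are free of \<open>l\<close> and \<open>m\<close>.
  \<open>bond\<close> is not an eigenfunction of \<open>qdiff\<close>. It gets multiplied by
  \<open>bond_ev\<close>, and the symmetry of this multiplier under exchange of the two arguments
  and reversal of the species is what makes the method work. The identities are kept valid for all
  \<open>l \<noteq> 0\<close>, beyond the probabilistic range, because the jump rates are two-sided
  derivatives at \<open>l = 1\<close>. In \<open>Dual\<close>, all bases are odd powers of
  \<open>q\<close>, so no factor vanishes and quotients may be regrouped along bonds. In continuous
  time only right derivatives at time 0 are given on an infinite state space. It must first be shown
  that no mass leaves the finite class with fixed particle numbers.\<close>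

definition vecs :: "nat \<Rightarrow> (nat \<Rightarrow> nat) set" where
  "vecs n = {v. \<forall>i\<ge>n. v i = 0}"

lemma vecs_le: "g \<le> b \<Longrightarrow> b \<in> vecs n \<Longrightarrow> g \<in> vecs n"
  unfolding vecs_def le_fun_def by clarsimp (metis le_zero_eq)

text \<open>Since \<open>b\<close> vanishes at \<open>n\<close>, this coordinate ranges freely over
  \<open>{..k}\<close>. Peeling it off allows sums over boxes to be evaluated by induction on the
  number of species.\<close>

lemma bij_betw_box_upd:
  assumes "b \<in> vecs n"
  shows "bij_betw (\<lambda>(g, c). g(n := c)) ({..b} \<times> {..k}) {..b(n := k)}"
proof (rule bij_betw_byWitness[where f' = "\<lambda>g. (g(n := 0), g n)"])
  have b: "b n = 0" using assms by (simp add: vecs_def)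
  show "\<forall>a\<in>{..b} \<times> {..k}. (\<lambda>g. (g(n := 0), g n)) (case a of (g, c) \<Rightarrow> g(n := c)) = a"
  proof (intro ballI, elim SigmaE)
    fix a g and c :: nat assume a: "a = (g, c)" and "g \<in> {..b}"
    then have "g n = 0" using b by (auto simp: le_fun_def dest: spec[of _ n])
    then show "(\<lambda>g. (g(n := 0), g n)) (case a of (g, c) \<Rightarrow> g(n := c)) = a"
      by (auto simp: a)
  qed
  show "\<forall>a'\<in>{..b(n := k)}. (case (a'(n := 0), a' n) of (g, c) \<Rightarrow> g(n := c)) = a'"
    by auto
  show "(\<lambda>(g, c). g(n := c)) ` ({..b} \<times> {..k}) \<subseteq> {..b(n := k)}"
    by (auto simp: le_fun_def)
  show "(\<lambda>g. (g(n := 0), g n)) ` {..b(n := k)} \<subseteq> {..b} \<times> {..k}"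
    by (auto simp: le_fun_def split: if_splits)
qed

lemma sum_box_upd:
  fixes f :: "(nat \<Rightarrow> nat) \<Rightarrow> 'a::comm_monoid_add"
  assumes "b \<in> vecs n"
  shows "(\<Sum>g\<in>{..b(n := k)}. f g) = (\<Sum>g\<in>{..b}. \<Sum>c\<le>k. f (g(n := c)))"
proof -
  have "(\<Sum>g\<in>{..b}. \<Sum>c\<le>k. f (g(n := c))) = (\<Sum>a\<in>{..b} \<times> {..k}. f (case a of (g, c) \<Rightarrow> g(n := c)))"
    by (simp add: sum.cartesian_product case_prod_unfold)
  also have "\<dots> = (\<Sum>g\<in>{..b(n := k)}. f g)"
    by (rule sum.reindex_bij_betw[OF bij_betw_box_upd[OF assms]])
  finally show ?thesis ..
qed

lemma vecs_0: "vecs 0 = {\<lambda>_. 0}"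
  by (auto simp: vecs_def)

lemma vecs_Suc_split:
  assumes "b \<in> vecs (Suc n)"
  shows "b(n := 0) \<in> vecs n" "b = (b(n := 0))(n := b n)"
  using assms by (auto simp: vecs_def Suc_le_eq)

lemma finite_box: "b \<in> vecs n \<Longrightarrow> finite {..b}"
proof (induction n arbitrary: b)
  case 0
  then have "{..b} = {\<lambda>_. 0}" by (auto simp: vecs_0 le_fun_def)
  then show ?case by simp
next
  case (Suc n)
  note s = vecs_Suc_split[OF Suc.prems]
  have "finite ({..b(n := 0)} \<times> {..b n})" 
    by (rule finite_cartesian_product[OF Suc.IH[OF s(1)] finite_atMost])
  then show ?case
    using bij_betw_finite[OF bij_betw_box_upd[OF s(1), of "b n"]] s(2) by simp
qed

lemma vsum_Suc: "vsum (Suc n) v = vsum n v + v n"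
  by (simp add: vsum_def)

lemma vsum_upd: "vsum n (v(n := c)) = vsum n v"
  by (simp add: vsum_def)

lemma vsum_mono: "g \<le> b \<Longrightarrow> vsum n g \<le> vsum n b"
  by (auto simp: vsum_def le_fun_def intro!: sum_mono)

text \<open>A coordinate where \<open>g\<close> falls short of \<open>b\<close> must be among the
  first \<open>n\<close>. This makes \<open>vsum n\<close> the measure for the recursion and the
  induction over the basis indices.\<close>

lemma vsum_strict_mono:
  assumes "g < b" "b \<in> vecs n"
  shows "vsum n g < vsum n b"
proof -
  have le: "g \<le> b" using assms by simp
  obtain i where i: "\<not> b i \<le> g i" using assms(1) by (auto simp: less_fun_def le_fun_def)
  have "i < n" using i assms(2) by (cases "i < n") (auto simp: vecs_def)
  then show ?thesis unfolding vsum_def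
    using le i by (intro sum_strict_mono_ex1) (auto simp: le_fun_def not_le)
qed

lemma vsum_add: "vsum n (\<lambda>i. g i + k i) = vsum n g + vsum n k"
  by (simp add: vsum_def sum.distrib)

section \<open>q-Pochhammer symbols, q-binomial coefficients and the normalisation of the
  weights\<close>

lemma qpoch_0 [simp]: "qpoch a Q 0 = 1"
  by (simp add: qpoch_def)

lemma qpoch_Suc: "qpoch a Q (Suc k) = qpoch a Q k * (1 - a * Q ^ k)"
  by (simp add: qpoch_def)

lemma qpoch_add: "qpoch a Q (k + j) = qpoch a Q k * qpoch (a * Q ^ k) Q j"
  by (induction j) (simp_all add: qpoch_Suc power_add mult_ac)

lemma qpoch_nonneg: "0 \<le> Q \<Longrightarrow> Q \<le> 1 \<Longrightarrow> a \<le> 1 \<Longrightarrow> 0 \<le> qpoch a Q k"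
  unfolding qpoch_def
proof (intro prod_nonneg ballI)
  fix j assume a: "0 \<le> Q" "Q \<le> 1" "a \<le> 1"
  have "a * Q ^ j \<le> 1 * Q ^ j" using a by (intro mult_right_mono) auto
  also have "\<dots> \<le> 1" using a by (simp add: power_le_one)
  finally show "0 \<le> 1 - a * Q ^ j" by simp
qed

lemma qpoch_pos: "0 \<le> Q \<Longrightarrow> Q \<le> 1 \<Longrightarrow> 0 \<le> a \<Longrightarrow> a < 1 \<Longrightarrow> 0 < qpoch a Q k"
  unfolding qpoch_def
proof (intro prod_pos ballI)
  fix j assume a: "0 \<le> Q" "Q \<le> 1" "0 \<le> a" "a < 1"
  have "a * Q ^ j \<le> a * 1" using a by (intro mult_left_mono power_le_one) auto
  then show "0 < 1 - a * Q ^ j" using a by simp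
qed

definition qbinom :: "real \<Rightarrow> nat \<Rightarrow> nat \<Rightarrow> real" where
  "qbinom Q b c = (if c \<le> b then qpoch Q Q b / (qpoch Q Q c * qpoch Q Q (b - c)) else 0)"

text \<open>One of the two q-Pascal rules; it rests on splitting \<open>1 - Q ^ (b + 1)\<close> as
  \<open>Q ^ (b - c) * (1 - Q ^ (c + 1)) + (1 - Q ^ (b - c))\<close>.\<close>

lemma qbinom_Suc_Suc:
  assumes "0 < Q" "Q < 1" "c \<le> b"
  shows "qbinom Q (Suc b) (Suc c) = Q ^ (b - c) * qbinom Q b c + qbinom Q b (Suc c)"
proof -
  have nz: "qpoch Q Q k \<noteq> 0" for k
    using qpoch_pos[of Q Q k] assms by simp
  show ?thesis
  proof (cases "c = b")
    case True
    then show ?thesis using nz by (simp add: qbinom_def)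
  next
    case False
    then obtain d where d: "b = c + Suc d"
      using assms(3) by (metis less_imp_add_positive le_neq_implies_less gr0_conv_Suc)
    have nzc: "1 - Q * Q ^ k \<noteq> 0" for k
      using nz[of "Suc k"] by (auto simp: qpoch_Suc)
    have *: "qpoch Q Q (Suc b) = qpoch Q Q b * (1 - Q * Q ^ b)"
      "qpoch Q Q (Suc c) = qpoch Q Q c * (1 - Q * Q ^ c)"
      "qpoch Q Q (Suc d) = qpoch Q Q d * (1 - Q * Q ^ d)"
      by (simp_all add: qpoch_Suc)
    have "qpoch Q Q (Suc b) / (qpoch Q Q (Suc c) * qpoch Q Q (Suc d)) =
       Q ^ Suc d * (qpoch Q Q b / (qpoch Q Q c * qpoch Q Q (Suc d))) +
       qpoch Q Q b / (qpoch Q Q (Suc c) * qpoch Q Q d)"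
    proof -
      have key: "1 - Q * Q ^ b = Q ^ Suc d * (1 - Q * Q ^ c) + (1 - Q * Q ^ d)"
        by (simp add: d algebra_simps power_add)
      have "x * (r * a + e) / (c * a * (f * e)) = r * (x / (c * (f * e))) + x / (c * a * f)"
        if "a \<noteq> 0" "e \<noteq> 0" for a c e f r x :: real
        using that by (simp add: add_divide_distrib distrib_left mult_ac)
      then show ?thesis unfolding * key using nzc[of c] nzc[of d] by blast
    qed
    then show ?thesis by (simp add: qbinom_def d)
  qed
qed

lemma qbinom_0: "0 < Q \<Longrightarrow> Q < 1 \<Longrightarrow> qbinom Q b 0 = 1"
  using qpoch_pos[of Q Q b] by (simp add: qbinom_def)

text \<open>The q-Pascal rule summed against \<open>Z\<close>: after a shift of index each
  coefficient of level \<open>b\<close> meets two neighbouring values of \<open>Z\<close>. It is the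
  induction step of the next evaluation.\<close>

lemma sum_qbinom_Suc:
  fixes Z :: "nat \<Rightarrow> real"
  assumes "0 < Q" "Q < 1"
  shows "(\<Sum>c\<le>Suc b. qbinom Q (Suc b) c * Z c)
    = (\<Sum>c\<le>b. qbinom Q b c * (Q ^ (b - c) * Z (Suc c) + Z c))"
proof -
  have "(\<Sum>c\<le>Suc b. qbinom Q (Suc b) c * Z c)
      = Z 0 + (\<Sum>c\<le>b. qbinom Q (Suc b) (Suc c) * Z (Suc c))"
    by (subst sum.atMost_Suc_shift) (simp add: qbinom_0 assms)
  also have "(\<Sum>c\<le>b. qbinom Q (Suc b) (Suc c) * Z (Suc c))
      = (\<Sum>c\<le>b. qbinom Q b c * (Q ^ (b - c) * Z (Suc c))) + (\<Sum>c\<le>b. qbinom Q b (Suc c) * Z (Suc c))"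
    unfolding sum.distrib[symmetric]
    by (intro sum.cong refl) (simp add: qbinom_Suc_Suc assms algebra_simps)
  also have "Z 0 + (\<dots>) = (\<Sum>c\<le>b. qbinom Q b c * (Q ^ (b - c) * Z (Suc c)))
      + (\<Sum>c\<le>Suc b. qbinom Q b c * Z c)"
    unfolding sum.atMost_Suc_shift[of "\<lambda>c. qbinom Q b c * Z c"] by (simp add: qbinom_0 assms)
  also have "(\<Sum>c\<le>Suc b. qbinom Q b c * Z c) = (\<Sum>c\<le>b. qbinom Q b c * Z c)"
    by (simp add: qbinom_def)
  finally show ?thesis by (simp add: distrib_left sum.distrib)
qed

text \<open>A q-Chu-Vandermonde sum for a single species. The offsets record the other species:
  \<open>A\<close> particles already chosen to jump and \<open>R\<close> chosen to stay.\<close>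

lemma sum_qbinom_qpoch:
  fixes l \<nu> :: real
  assumes "0 < Q" "Q < 1"
  shows "(\<Sum>c\<le>b. qbinom Q b c * (Q ^ (R * c) * (\<nu> ^ (A + c) * qpoch l Q (A + c) * qpoch \<nu> Q (R + b - c))))
    = \<nu> ^ A * qpoch l Q A * qpoch \<nu> Q R * qpoch (\<nu> * l * Q ^ (A + R)) Q b"
proof (induction b)
  case 0
  then show ?case by (simp add: qbinom_0 assms)
next
  case (Suc b)
  define Z where "Z = (\<lambda>b c. Q ^ (R * c) * (\<nu> ^ (A + c) * qpoch l Q (A + c) * qpoch \<nu> Q (R + b - c)))"
  \<comment> \<open>The two neighbouring summands combine to a multiple of the old one whose factor
    does not depend on \<open>c\<close>, so it leaves the sum and becomes the new last factor of the
    Pochhammer symbol.\<close>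
  have step: "Q ^ (b - c) * Z (Suc b) (Suc c) + Z (Suc b) c = (1 - \<nu> * l * Q ^ (A + R + b)) * Z b c"
    if cb: "c \<le> b" for c
  proof -
    obtain d where d: "b = c + d" using le_Suc_ex[OF cb] by blast
    have 1: "Z (Suc b) (Suc c) = Z b c * (Q ^ R * \<nu> * (1 - l * Q ^ (A + c)))"
      by (simp add: Z_def d qpoch_Suc power_add)
    have "R + Suc b - c = Suc (R + d)" "R + b - c = R + d" by (simp_all add: d)
    then have 2: "Z (Suc b) c = Z b c * (1 - \<nu> * Q ^ (R + d))"
      by (simp add: Z_def qpoch_Suc)
    have "Q ^ (b - c) * (Q ^ R * \<nu> * (1 - l * Q ^ (A + c))) + (1 - \<nu> * Q ^ (R + d))
        = 1 - \<nu> * l * Q ^ (A + R + b)"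
      by (simp add: d power_add algebra_simps)
    moreover have "x * (y * a) + y * e = (x * a + e) * y" for x y a e :: real
      by (simp add: algebra_simps)
    ultimately show ?thesis unfolding 1 2 by metis
  qed
  have "(\<Sum>c\<le>Suc b. qbinom Q (Suc b) c * Z (Suc b) c)
      = (\<Sum>c\<le>b. qbinom Q b c * (Q ^ (b - c) * Z (Suc b) (Suc c) + Z (Suc b) c))"
    by (rule sum_qbinom_Suc[OF assms])
  also have "\<dots> = (\<Sum>c\<le>b. (1 - \<nu> * l * Q ^ (A + R + b)) * (qbinom Q b c * Z b c))"
    by (intro sum.cong refl) (simp add: step)
  also have "\<dots> = (1 - \<nu> * l * Q ^ (A + R + b)) * (\<Sum>c\<le>b. qbinom Q b c * Z b c)"
    by (simp add: sum_distrib_left)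
  also have "(\<Sum>c\<le>b. qbinom Q b c * Z b c)
      = \<nu> ^ A * qpoch l Q A * qpoch \<nu> Q R * qpoch (\<nu> * l * Q ^ (A + R)) Q b"
    unfolding Z_def by (rule Suc.IH)
  also have "(1 - \<nu> * l * Q ^ (A + R + b)) * (\<nu> ^ A * qpoch l Q A * qpoch \<nu> Q R * qpoch (\<nu> * l * Q ^ (A + R)) Q b)
      = \<nu> ^ A * qpoch l Q A * qpoch \<nu> Q R * qpoch (\<nu> * l * Q ^ (A + R)) Q (Suc b)"
    by (simp add: power_add qpoch_Suc)
  finally show ?case unfolding Z_def .
qed

text \<open>Induction on the species. The sum over the last one is \<open>sum_qbinom_qpoch\<close>
  with \<open>A = vsum n g\<close> and \<open>R = vsum n b' - vsum n g\<close>; the new factor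
  depends only on \<open>A + R = vsum n b'\<close> and comes out of the sum over
  \<open>g\<close>.\<close>

lemma sum_box_qbinom_qpoch:
  fixes l \<nu> :: real
  assumes Q: "0 < Q" "Q < 1" and "b \<in> vecs n"
  shows "(\<Sum>g\<in>{..b}. Q ^ (\<Sum>j<n. \<Sum>i<j. (b i - g i) * g j) * (\<Prod>i<n. qbinom Q (b i) (g i))
      * (\<nu> ^ vsum n g * qpoch l Q (vsum n g) * qpoch \<nu> Q (vsum n b - vsum n g)))
    = qpoch (\<nu> * l) Q (vsum n b)"
  using assms(3)
proof (induction n arbitrary: b)
  case 0
  then have "{..b} = {\<lambda>_. 0}" by (auto simp: vecs_0 le_fun_def)
  then show ?case by (simp add: vsum_def)
next
  case (Suc n)
  define b' k where "b' = b(n := 0)" and "k = b n"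
  have b': "b' \<in> vecs n" and b: "b = b'(n := k)"
    using vecs_Suc_split[OF Suc.prems] by (simp_all add: b'_def k_def)
  have vb: "vsum (Suc n) b = vsum n b' + k" by (simp add: b vsum_Suc vsum_upd)
  have "(\<Sum>g\<in>{..b}. Q ^ (\<Sum>j<Suc n. \<Sum>i<j. (b i - g i) * g j) * (\<Prod>i<Suc n. qbinom Q (b i) (g i))
      * (\<nu> ^ vsum (Suc n) g * qpoch l Q (vsum (Suc n) g) * qpoch \<nu> Q (vsum (Suc n) b - vsum (Suc n) g)))
    = (\<Sum>g\<in>{..b'}. \<Sum>c\<le>k. Q ^ (\<Sum>j<n. \<Sum>i<j. (b' i - g i) * g j) * (\<Prod>i<n. qbinom Q (b' i) (g i))
       * (qbinom Q k c * (Q ^ ((vsum n b' - vsum n g) * c) *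
      (\<nu> ^ (vsum n g + c) * qpoch l Q (vsum n g + c) * qpoch \<nu> Q ((vsum n b' - vsum n g) + k - c)))))"
    unfolding vb unfolding b sum_box_upd[OF b']
  proof (intro sum.cong refl)
    fix g c assume g: "g \<in> {..b'}" and c: "c \<in> {..k}"
    have le: "vsum n g \<le> vsum n b'" using g by (auto intro: vsum_mono)
    have e: "(\<Sum>i<n. (b' i - g i) * c) = (vsum n b' - vsum n g) * c"
      using g unfolding vsum_def
      by (simp add: sum_distrib_right[symmetric] sum_subtractf_nat le_fun_def)
    show "Q ^ (\<Sum>j<Suc n. \<Sum>i<j. ((b'(n := k)) i - (g(n := c)) i) * (g(n := c)) j) *
         (\<Prod>i<Suc n. qbinom Q ((b'(n := k)) i) ((g(n := c)) i)) *
         (\<nu> ^ vsum (Suc n) (g(n := c)) * qpoch l Q (vsum (Suc n) (g(n := c))) *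
          qpoch \<nu> Q (vsum n b' + k - vsum (Suc n) (g(n := c)))) =
         Q ^ (\<Sum>j<n. \<Sum>i<j. (b' i - g i) * g j) *
         (\<Prod>i<n. qbinom Q (b' i) (g i)) *
         (qbinom Q k c *
          (Q ^ ((vsum n b' - vsum n g) * c) *
           (\<nu> ^ (vsum n g + c) * qpoch l Q (vsum n g + c) *
            qpoch \<nu> Q (vsum n b' - vsum n g + k - c))))"
      using le c unfolding power_add by (simp add: vsum_Suc vsum_upd e power_add)
  qed
  also have "\<dots> = (\<Sum>g\<in>{..b'}. Q ^ (\<Sum>j<n. \<Sum>i<j. (b' i - g i) * g j) * (\<Prod>i<n. qbinom Q (b' i) (g i))
       * (\<nu> ^ vsum n g * qpoch l Q (vsum n g) * qpoch \<nu> Q (vsum n b' - vsum n g)))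
       * qpoch (\<nu> * l * Q ^ vsum n b') Q k"
    unfolding sum_distrib_left[symmetric] sum_qbinom_qpoch[OF Q] sum_distrib_right
    by (intro sum.cong refl) (simp add: vsum_mono mult_ac)
  also have "\<dots> = qpoch (\<nu> * l) Q (vsum (Suc n) b)"
    unfolding Suc.IH[OF b'] vb by (simp add: qpoch_add)
  finally show ?case .
qed

text \<open>An algebraic identity in \<open>l\<close>, not confined to
  \<open>m \<le> l \<le> 1\<close>: it will be used with both parameters scaled by a power of
  \<open>Q\<close>, and on both sides of \<open>l = 1\<close>.\<close>

lemma sum_Phi:
  assumes Q: "0 < Q" "Q < 1" and m: "0 \<le> m" "m < 1" and l: "l \<noteq> 0" and b: "b \<in> vecs n"
  shows "(\<Sum>g\<in>{..b}. Phi n Q g b l m) = 1"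
proof -
  have nz: "qpoch m Q (vsum n b) \<noteq> 0"
    using qpoch_pos[of Q m "vsum n b"] Q m by simp
  have "(\<Sum>g\<in>{..b}. Phi n Q g b l m)
    = (\<Sum>g\<in>{..b}. Q ^ (\<Sum>j<n. \<Sum>i<j. (b i - g i) * g j) * (\<Prod>i<n. qbinom Q (b i) (g i))
      * ((m / l) ^ vsum n g * qpoch l Q (vsum n g) * qpoch (m / l) Q (vsum n b - vsum n g)))
      / qpoch m Q (vsum n b)"
    unfolding sum_divide_distrib
    by (intro sum.cong refl) (simp add: Phi_def qbinom_def le_fun_def)
  also have "\<dots> = 1"
    unfolding sum_box_qbinom_qpoch[OF Q b] using l nz by simp
  finally show ?thesis .
qed

section \<open>Diagonalisation of the averaging operator\<close>

text \<open>For \<open>g < k\<close> the factor \<open>j = g\<close> vanishes; the truncated factors after it are irrelevant.\<close>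

definition qff :: "real \<Rightarrow> nat \<Rightarrow> nat \<Rightarrow> real" where
  "qff Q g k = (\<Prod>j<k. 1 - Q ^ (g - j))"

lemma qff_eq_0: "g < k \<Longrightarrow> qff Q g k = 0"
  unfolding qff_def by (rule prod_zero) (auto intro!: bexI[of _ g])

lemma qff_add: "qff Q (g + k) k * qpoch Q Q g = qpoch Q Q (g + k)"
proof (induction k)
  case 0
  then show ?case by (simp add: qff_def)
next
  case (Suc k)
  have "qff Q (g + Suc k) (Suc k) = (1 - Q ^ (g + Suc k)) * qff Q (g + k) k"
    unfolding qff_def by (subst prod.lessThan_Suc_shift) simp
  then show ?case using Suc.IH by (simp add: qpoch_Suc mult_ac)
qed

text \<open>Both sides are the product of \<open>1 - Q ^ (g - j)\<close> over
  \<open>j \<le> k\<close>, with the first or the last factor split off.\<close>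

lemma qff_Suc_left:
  assumes "k \<le> g"
  shows "(1 - Q ^ g) * qff Q (g - 1) k = qff Q g k * (1 - Q ^ (g - k))"
proof (cases g)
  case 0
  then show ?thesis by simp
next
  case (Suc g')
  have "(1 - Q ^ Suc g') * qff Q g' k = qff Q (Suc g') (Suc k)"
    unfolding qff_def prod.lessThan_Suc_shift by simp
  also have "\<dots> = qff Q (Suc g') k * (1 - Q ^ (Suc g' - k))"
    by (simp add: qff_def)
  finally show ?thesis using Suc by simp
qed

text \<open>For \<open>k \<le> g\<close> this is, up to a constant depending on \<open>k\<close>,
  the species part of the weight \<open>Phi\<close> for drawing \<open>k\<close> from
  \<open>g\<close>: the same power of \<open>Q\<close> and a product of q-binomial coefficients. It
  vanishes unless \<open>k \<le> g\<close>, which makes the family triangular.\<close>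

definition efun :: "nat \<Rightarrow> real \<Rightarrow> (nat \<Rightarrow> nat) \<Rightarrow> (nat \<Rightarrow> nat) \<Rightarrow> real" where
  "efun n Q k g = Q ^ (\<Sum>j<n. \<Sum>i<j. (g i - k i) * k j) * (\<Prod>i<n. qff Q (g i) (k i))"

lemma efun_eq_0:
  assumes "\<not> k \<le> g" "k \<in> vecs n"
  shows "efun n Q k g = 0"
proof -
  obtain i where i: "g i < k i" using assms(1) by (auto simp: le_fun_def not_le)
  then have "i < n" using assms(2) by (cases "i < n") (auto simp: vecs_def)
  then have "(\<Prod>i<n. qff Q (g i) (k i)) = 0"
    using i by (intro prod_zero) (auto intro!: bexI[of _ i] qff_eq_0)
  then show ?thesis by (simp add: efun_def)
qed

lemma efun_self:
  assumes "0 < Q" "Q < 1"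
  shows "efun n Q k k \<noteq> 0"
proof -
  have "qff Q j j \<noteq> 0" for j
    using qff_add[of Q 0 j] qpoch_pos[of Q Q j] assms by simp
  then show ?thesis using assms by (simp add: efun_def)
qed

definition Phi_op :: "nat \<Rightarrow> real \<Rightarrow> real \<Rightarrow> real \<Rightarrow> ((nat \<Rightarrow> nat) \<Rightarrow> real) \<Rightarrow> (nat \<Rightarrow> nat) \<Rightarrow> real" where
  "Phi_op n Q l m f b = (\<Sum>g\<in>{..b}. Phi n Q g b l m * f g)"

definition evalue :: "real \<Rightarrow> real \<Rightarrow> real \<Rightarrow> nat \<Rightarrow> real" where
  "evalue Q l m d = (m / l) ^ d * qpoch l Q d / qpoch m Q d"

text \<open>The q-factorials of \<open>g + k\<close> and \<open>b + k\<close> are traded for those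
  of \<open>g\<close> and \<open>b\<close> through \<open>qff_add\<close>, and
  \<open>qpoch_add\<close> splits the first \<open>vsum n k\<close> factors off the symbols in
  \<open>l\<close> and \<open>m\<close>. These form \<open>evalue\<close>; the ratio
  \<open>m / l\<close> is unaffected by the common scaling.\<close>

lemma Phi_efun_shift:
  fixes Q l m :: real and g b k :: "nat \<Rightarrow> nat"
  assumes Q: "0 < Q" "Q < 1" and m: "0 \<le> m" "m < 1" and l: "l \<noteq> 0" and le: "g \<le> b"
  shows "Phi n Q (\<lambda>i. g i + k i) (\<lambda>i. b i + k i) l m * efun n Q k (\<lambda>i. g i + k i)
    = evalue Q l m (vsum n k) * efun n Q k (\<lambda>i. b i + k i)
      * Phi n Q g b (l * Q ^ vsum n k) (m * Q ^ vsum n k)"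
proof -
  have nz: "qpoch Q Q j \<noteq> 0" for j using qpoch_pos[of Q Q j] Q by simp
  have e: "(\<Sum>j<n. \<Sum>i<j. (b i - g i) * (g j + k j)) + (\<Sum>j<n. \<Sum>i<j. g i * k j)
     = (\<Sum>j<n. \<Sum>i<j. b i * k j) + (\<Sum>j<n. \<Sum>i<j. (b i - g i) * g j)"
  proof -
    have "(b i - g i) * (g j + k j) + g i * k j = b i * k j + (b i - g i) * g j" for i j
    proof -
      obtain d where "b i = g i + d" using le le_Suc_ex[of "g i" "b i"] by (auto simp: le_fun_def)
      then show ?thesis by (simp add: algebra_simps)
    qed
    then show ?thesis unfolding sum.distrib[symmetric] by simp
  qed
  have p: "(\<Prod>i<n. qpoch Q Q (b i + k i) / (qpoch Q Q (g i + k i) * qpoch Q Q (b i - g i)))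
       * (\<Prod>i<n. qff Q (g i + k i) (k i))
      = (\<Prod>i<n. qpoch Q Q (b i) / (qpoch Q Q (g i) * qpoch Q Q (b i - g i)))
       * (\<Prod>i<n. qff Q (b i + k i) (k i))"
    unfolding prod.distrib[symmetric]
  proof (rule prod.cong[OF refl])
    fix i
    have "qff Q (g i + k i) (k i) = qpoch Q Q (g i + k i) / qpoch Q Q (g i)"
      "qff Q (b i + k i) (k i) = qpoch Q Q (b i + k i) / qpoch Q Q (b i)"
      using nz qff_add[of Q "g i" "k i"] qff_add[of Q "b i" "k i"] by (simp_all add: eq_divide_eq)
    then show "qpoch Q Q (b i + k i) / (qpoch Q Q (g i + k i) * qpoch Q Q (b i - g i)) * qff Q (g i + k i) (k i) =
         qpoch Q Q (b i) / (qpoch Q Q (g i) * qpoch Q Q (b i - g i)) * qff Q (b i + k i) (k i)"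
      using nz by (simp add: field_simps)
  qed
  have ml: "m * Q ^ vsum n k / (l * Q ^ vsum n k) = m / l" using Q by simp
  have w: "(m / l) ^ (vsum n g + vsum n k)
      * (qpoch l Q (vsum n g + vsum n k) * x / qpoch m Q (vsum n b + vsum n k))
      = evalue Q l m (vsum n k) * ((m / l) ^ vsum n g
        * (qpoch (l * Q ^ vsum n k) Q (vsum n g) * x / qpoch (m * Q ^ vsum n k) Q (vsum n b)))" for x
    unfolding evalue_def by (simp add: power_add qpoch_add add.commute[of "vsum n g"] add.commute[of "vsum n b"])
  have "Phi n Q (\<lambda>i. g i + k i) (\<lambda>i. b i + k i) l m * efun n Q k (\<lambda>i. g i + k i)
    = Q ^ ((\<Sum>j<n. \<Sum>i<j. (b i - g i) * (g j + k j)) + (\<Sum>j<n. \<Sum>i<j. g i * k j))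
      * ((m / l) ^ (vsum n g + vsum n k)
      * (qpoch l Q (vsum n g + vsum n k) * qpoch (m / l) Q (vsum n b - vsum n g) / qpoch m Q (vsum n b + vsum n k)))
      * ((\<Prod>i<n. qpoch Q Q (b i + k i) / (qpoch Q Q (g i + k i) * qpoch Q Q (b i - g i)))
       * (\<Prod>i<n. qff Q (g i + k i) (k i)))"
    unfolding Phi_def efun_def vsum_add power_add by (simp add: mult_ac)
  also have "\<dots> = evalue Q l m (vsum n k) * efun n Q k (\<lambda>i. b i + k i)
      * Phi n Q g b (l * Q ^ vsum n k) (m * Q ^ vsum n k)"
    unfolding w p e unfolding Phi_def efun_def ml power_add by (simp add: mult_ac)
  finally show ?thesis .
qed

text \<open>Only vectors above \<open>k\<close> contribute. Writing them as \<open>g + k\<close>,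
  what remains is the total mass of the weights with scaled parameters, which is 1.\<close>

lemma Phi_op_efun:
  assumes Q: "0 < Q" "Q < 1" and m: "0 \<le> m" "m < 1" and l: "l \<noteq> 0"
    and b: "b \<in> vecs n" and k: "k \<in> vecs n"
  shows "Phi_op n Q l m (efun n Q k) b = evalue Q l m (vsum n k) * efun n Q k b"
proof (cases "k \<le> b")
  case False
  then have "\<not> k \<le> g" if "g \<in> {..b}" for g using that by auto
  then have "Phi_op n Q l m (efun n Q k) b = 0"
    unfolding Phi_op_def by (intro sum.neutral) (simp add: efun_eq_0[OF _ k])
  then show ?thesis using efun_eq_0[OF False k] by simp
next
  case True
  define b' where "b' = (\<lambda>i. b i - k i)"
  have bb: "b = (\<lambda>i. b' i + k i)" using True by (auto simp: b'_def le_fun_def)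
  have b': "b' \<in> vecs n" using b by (auto simp: b'_def vecs_def)
  have bij: "bij_betw (\<lambda>g i. g i + k i) {..b'} {g\<in>{..b}. k \<le> g}"
    by (rule bij_betw_byWitness[where f' = "\<lambda>g i. g i - k i"])
       (auto simp: bb le_fun_def le_diff_conv)
  have "Phi_op n Q l m (efun n Q k) b = (\<Sum>g\<in>{g\<in>{..b}. k \<le> g}. Phi n Q g b l m * efun n Q k g)"
    unfolding Phi_op_def using finite_box[OF b] efun_eq_0[OF _ k]
    by (intro sum.mono_neutral_right) auto
  also have "\<dots> = (\<Sum>g\<in>{..b'}. Phi n Q (\<lambda>i. g i + k i) (\<lambda>i. b' i + k i) l m * efun n Q k (\<lambda>i. g i + k i))"
    by (subst sum.reindex_bij_betw[OF bij, symmetric]) (simp add: bb)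
  also have "\<dots> = evalue Q l m (vsum n k) * efun n Q k b
      * (\<Sum>g\<in>{..b'}. Phi n Q g b' (l * Q ^ vsum n k) (m * Q ^ vsum n k))"
    unfolding sum_distrib_left
    by (intro sum.cong refl, subst Phi_efun_shift[OF Q m l]) (auto simp: bb)
  also have "(\<Sum>g\<in>{..b'}. Phi n Q g b' (l * Q ^ vsum n k) (m * Q ^ vsum n k)) = 1"
  proof (rule sum_Phi[OF Q _ _ _ b'])
    have "m * Q ^ vsum n k \<le> m * 1" using Q m by (intro mult_left_mono power_le_one) auto
    then show "m * Q ^ vsum n k < 1" using m by simp
  qed (use Q m l in auto)
  finally show ?thesis by simp
qed

text \<open>For \<open>b j = 0\<close> the truncated \<open>b j - 1\<close> is harmless, since then \<open>1 - Q ^ b j = 0\<close>.\<close>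

definition qdiff :: "nat \<Rightarrow> real \<Rightarrow> ((nat \<Rightarrow> nat) \<Rightarrow> real) \<Rightarrow> (nat \<Rightarrow> nat) \<Rightarrow> real" where
  "qdiff n Q f b = f b / Q ^ vsum n b
     - (\<Sum>j<n. (1 - Q ^ b j) / Q ^ vsum (Suc j) b * f (b(j := b j - 1)))"

text \<open>Removing one particle of species \<open>j\<close> changes a single q-factorial, and
  lowers the exponent of \<open>Q\<close> by the sum of \<open>k l\<close> over
  \<open>l > j\<close>, that is, by \<open>vsum n k - vsum (Suc j) k\<close>.\<close>

lemma efun_remove:
  assumes Q: "0 < Q" and le: "k \<le> b" and j: "j < n"
  shows "(1 - Q ^ b j) * efun n Q k (b(j := b j - 1)) * Q ^ vsum n k
     = efun n Q k b * (1 - Q ^ (b j - k j)) * Q ^ vsum (Suc j) k"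
proof -
  define b' where "b' = b(j := b j - 1)"
  have kj: "k j \<le> b j" using le by (simp add: le_fun_def)
  have "(\<Prod>i<n. qff Q (b' i) (k i)) = qff Q (b j - 1) (k j) * (\<Prod>i\<in>{..<n} - {j}. qff Q (b' i) (k i))"
    using j by (subst prod.remove[of _ j]) (auto simp: b'_def)
  also have "(\<Prod>i\<in>{..<n} - {j}. qff Q (b' i) (k i)) = (\<Prod>i\<in>{..<n} - {j}. qff Q (b i) (k i))"
    by (intro prod.cong) (auto simp: b'_def)
  finally have "(1 - Q ^ b j) * (\<Prod>i<n. qff Q (b' i) (k i))
      = (1 - Q ^ (b j - k j)) * (qff Q (b j) (k j) * (\<Prod>i\<in>{..<n} - {j}. qff Q (b i) (k i)))"
    using qff_Suc_left[OF kj, of Q] by simp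
  also have "qff Q (b j) (k j) * (\<Prod>i\<in>{..<n} - {j}. qff Q (b i) (k i)) = (\<Prod>i<n. qff Q (b i) (k i))"
    using j by (subst (2) prod.remove[of _ j]) auto
  finally have p: "(1 - Q ^ b j) * (\<Prod>i<n. qff Q (b' i) (k i))
      = (1 - Q ^ (b j - k j)) * (\<Prod>i<n. qff Q (b i) (k i))" .
  show ?thesis
  \<comment> \<open>If the removal leaves the region above \<open>k\<close>, the exponent is
    affected by truncated subtraction and the comparison fails, but then both sides are
    zero.\<close>
  proof (cases "b j = k j")
    case True
    then have "(1 - Q ^ b j) * efun n Q k b' = 0" using p by (auto simp: efun_def)
    then show ?thesis using True by (simp add: b'_def)
  next
    case False
    then have gt: "k j < b j" using kj by simp
    have "(\<Sum>i<l. (b i - k i) * k l) = (\<Sum>i<l. (b' i - k i) * k l) + (if j < l then k l else 0)" for l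
    proof -
      have "(\<Sum>i<l. (b i - k i) * k l) = (\<Sum>i<l. (b' i - k i) * k l + (if i = j then k l else 0))"
      proof (rule sum.cong[OF refl])
        fix i
        obtain d where "b j = k j + Suc d" using gt less_imp_Suc_add by auto
        then show "(b i - k i) * k l = (b' i - k i) * k l + (if i = j then k l else 0)"
          by (auto simp: b'_def)
      qed
      then show ?thesis by (simp add: sum.distrib)
    qed
    then have "(\<Sum>l<n. \<Sum>i<l. (b i - k i) * k l)
       = (\<Sum>l<n. \<Sum>i<l. (b' i - k i) * k l) + (\<Sum>l<n. if j < l then k l else 0)"
      by (simp add: sum.distrib)
    moreover have "(\<Sum>l<n. if j < l then k l else 0) + vsum (Suc j) k = vsum n k"
    proof -
      have "(\<Sum>l<n. if j < l then k l else 0) = (\<Sum>l\<in>{..<n} - {..<Suc j}. k l)"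
        by (intro sum.mono_neutral_cong_right) auto
      then show ?thesis
        using j sum.subset_diff[of "{..<Suc j}" "{..<n}" k] by (simp add: vsum_def del: sum.lessThan_Suc)
    qed
    ultimately have e: "(\<Sum>l<n. \<Sum>i<l. (b' i - k i) * k l) + vsum n k
        = (\<Sum>l<n. \<Sum>i<l. (b i - k i) * k l) + vsum (Suc j) k" by linarith
    have "(1 - Q ^ b j) * efun n Q k b' * Q ^ vsum n k
        = Q ^ ((\<Sum>l<n. \<Sum>i<l. (b' i - k i) * k l) + vsum n k)
          * ((1 - Q ^ b j) * (\<Prod>i<n. qff Q (b' i) (k i)))"
      by (simp add: efun_def power_add)
    also have "\<dots> = efun n Q k b * (1 - Q ^ (b j - k j)) * Q ^ vsum (Suc j) k"
      unfolding e p by (simp add: efun_def power_add)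
    finally show ?thesis by (simp add: b'_def)
  qed
qed

text \<open>With \<open>d = b - k\<close> the coefficients of \<open>qdiff\<close> are such that the
  removal terms become differences of \<open>1 / Q ^ vsum j d\<close> in \<open>j\<close>. The
  telescoped sum cancels the diagonal term up to \<open>efun n Q k b / Q ^ vsum n k\<close>.\<close>

lemma qdiff_efun:
  assumes Q: "0 < Q" and b: "b \<in> vecs n" and k: "k \<in> vecs n"
  shows "qdiff n Q (efun n Q k) b = efun n Q k b / Q ^ vsum n k"
proof (cases "k \<le> b")
  case False
  then have "\<not> k \<le> b(j := b j - 1)" for j
    by (auto simp: le_fun_def not_le split: if_splits) (metis diff_le_self le_trans not_less)
  then show ?thesis using False k by (simp add: qdiff_def efun_eq_0)
next
  case True
  define d where "d = (\<lambda>i. b i - k i)"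
  have bd: "b = (\<lambda>i. d i + k i)" using True by (auto simp: d_def le_fun_def)
  have "(1 - Q ^ b j) / Q ^ vsum (Suc j) b * efun n Q k (b(j := b j - 1))
     = efun n Q k b / Q ^ vsum n k * (1 / Q ^ vsum (Suc j) d - 1 / Q ^ vsum j d)" if "j < n" for j
  proof -
    have "vsum (Suc j) b = vsum j d + d j + vsum (Suc j) k"
      unfolding bd vsum_add by (simp add: vsum_Suc)
    then show ?thesis
      using efun_remove[OF Q True that] Q
      by (simp add: divide_simps vsum_Suc[of j d] power_add d_def[symmetric] fun_cong[OF d_def, symmetric])
  qed
  then have "(\<Sum>j<n. (1 - Q ^ b j) / Q ^ vsum (Suc j) b * efun n Q k (b(j := b j - 1)))
     = (\<Sum>j<n. efun n Q k b / Q ^ vsum n k * (1 / Q ^ vsum (Suc j) d - 1 / Q ^ vsum j d))"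
    by (intro sum.cong) auto
  also have "\<dots> = efun n Q k b / Q ^ vsum n k * (1 / Q ^ vsum n d - 1)"
    unfolding sum_distrib_left[symmetric] sum_lessThan_telescope[of "\<lambda>j. 1 / Q ^ vsum j d"]
    by (simp add: vsum_def)
  finally have "qdiff n Q (efun n Q k) b
      = efun n Q k b / Q ^ vsum n b - efun n Q k b / Q ^ vsum n k * (1 / Q ^ vsum n d - 1)"
    unfolding qdiff_def by simp
  moreover have "vsum n b = vsum n d + vsum n k"
    unfolding bd vsum_add ..
  ultimately show ?thesis using Q by (simp add: power_add field_simps)
qed

section \<open>Expansion in the triangular basis, and transfer of symmetry from \<open>qdiff\<close>
  to averaging\<close>

lemma efun_expansion:
  fixes f :: "(nat \<Rightarrow> nat) \<Rightarrow> real"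
  assumes Q: "0 < Q" "Q < 1"
  shows "\<exists>a. \<forall>b\<in>vecs n. f b = (\<Sum>k\<in>{..b}. a k * efun n Q k b)"
proof -
  have split: "(\<Sum>k\<in>{..b}. a k * efun n Q k b) = (\<Sum>k\<in>{..<b}. a k * efun n Q k b) + a b * efun n Q b b"
    if "b \<in> vecs n" for a b
  proof -
    have "{..b} = insert b {..<b}" by auto
    moreover have "finite {..<b}" using finite_box[OF that] by (rule rev_finite_subset) auto
    ultimately show ?thesis by simp
  qed
  \<comment> \<open>The triangular system is solved recursively: \<open>a b\<close> is determined by
    the coefficients strictly below \<open>b\<close>, as \<open>efun n Q b b\<close> is nonzero. The
    relation is restricted to \<open>vecs n\<close>, where \<open>vsum n\<close> proves it well
    founded.\<close>
  obtain a where a: "\<forall>b. b \<in> vecs n \<longrightarrow> f b = (\<Sum>k\<in>{..<b}. a k * efun n Q k b) + a b * efun n Q b b"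
  proof (rule exE[OF dependent_wf_choice[where R = "{(x, y). x < y \<and> y \<in> vecs n}"
        and P = "\<lambda>a b r. b \<in> vecs n \<longrightarrow> f b = (\<Sum>k\<in>{..<b}. a k * efun n Q k b) + r * efun n Q b b"]])
    have "{(x, y). x < y \<and> y \<in> vecs n} \<subseteq> Wellfounded.measure (vsum n)"
      using vsum_strict_mono by auto
    then show "wf {(x, y). x < y \<and> y \<in> vecs n}"
      by (rule wf_subset[OF wf_measure])
  next
    fix a a' :: "(nat \<Rightarrow> nat) \<Rightarrow> real" and b r
    assume "\<And>z. (z, b) \<in> {(x, y). x < y \<and> y \<in> vecs n} \<Longrightarrow> a z = a' z"
    then have "(\<Sum>k<b. a k * efun n Q k b) = (\<Sum>k<b. a' k * efun n Q k b)" if "b \<in> vecs n"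
      using that by (intro sum.cong) auto
    then show "(b \<in> vecs n \<longrightarrow> f b = (\<Sum>k<b. a k * efun n Q k b) + r * efun n Q b b) =
       (b \<in> vecs n \<longrightarrow> f b = (\<Sum>k<b. a' k * efun n Q k b) + r * efun n Q b b)"
      by (simp cong: imp_cong)
  next
    fix b and a :: "(nat \<Rightarrow> nat) \<Rightarrow> real"
    have "f b = (\<Sum>k<b. a k * efun n Q k b)
        + ((f b - (\<Sum>k<b. a k * efun n Q k b)) / efun n Q b b) * efun n Q b b"
      using efun_self[OF Q, of n b] by simp
    then show "\<exists>r. b \<in> vecs n \<longrightarrow> f b = (\<Sum>k<b. a k * efun n Q k b) + r * efun n Q b b"
      by blast
  qed
  then have "\<forall>b\<in>vecs n. f b = (\<Sum>k\<in>{..b}. a k * efun n Q k b)"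
    using split[of _ a] by simp
  then show ?thesis by (intro exI[of _ a])
qed

text \<open>Triangularity again: at \<open>b = k\<close> the coefficients below vanish by induction,
  and the diagonal value is nonzero.\<close>

lemma efun_independent:
  fixes a :: "(nat \<Rightarrow> nat) \<Rightarrow> real"
  assumes Q: "0 < Q" "Q < 1" and z: "\<And>b. b \<in> vecs n \<Longrightarrow> (\<Sum>k\<in>{..b}. a k * efun n Q k b) = 0"
    and k: "k \<in> vecs n"
  shows "a k = 0"
  using k
proof (induction "vsum n k" arbitrary: k rule: less_induct)
  case less
  have "finite {..<k}" using finite_box[OF less.prems] by (rule rev_finite_subset) auto
  moreover have "{..k} = insert k {..<k}" by auto
  moreover have "a j = 0" if "j \<in> {..<k}" for j
    using less.hyps[OF vsum_strict_mono[OF _ less.prems] vecs_le[OF _ less.prems]] that by simp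
  ultimately show ?case using z[OF less.prems] efun_self[OF Q, of n k] by simp
qed

text \<open>Gives one common index set for the expansions at all arguments \<open>g \<le> b\<close>,
  as the linearity lemmas below require.\<close>

lemma efun_sum_extend:
  assumes "g \<le> b" "b \<in> vecs n"
  shows "(\<Sum>k\<in>{..g}. a k * efun n Q k g) = (\<Sum>k\<in>{..b}. a k * efun n Q k g)"
proof (rule sum.mono_neutral_left)
  show "finite {..b}" by (rule finite_box[OF assms(2)])
  show "{..g} \<subseteq> {..b}" using assms(1) by auto
  show "\<forall>k\<in>{..b} - {..g}. a k * efun n Q k g = 0"
    using assms(2) by (auto simp: efun_eq_0 vecs_le)
qed

text \<open>The operator at \<open>b\<close> sees only values on the box below \<open>b\<close>, so
  linearity applies to expansions that are finite merely box by box.\<close>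

lemma qdiff_sum:
  assumes "\<And>g. g \<le> b \<Longrightarrow> f g = (\<Sum>k\<in>A. a k * F k g)"
  shows "qdiff n Q f b = (\<Sum>k\<in>A. a k * qdiff n Q (F k) b)"
proof -
  have le: "b(j := b j - 1) \<le> b" for j by (simp add: le_fun_def)
  have "qdiff n Q f b = (\<Sum>k\<in>A. a k * F k b) / Q ^ vsum n b
     - (\<Sum>j<n. (1 - Q ^ b j) / Q ^ vsum (Suc j) b * (\<Sum>k\<in>A. a k * F k (b(j := b j - 1))))"
    unfolding qdiff_def by (simp only: assms le order_refl)
  also have "(\<Sum>j<n. (1 - Q ^ b j) / Q ^ vsum (Suc j) b * (\<Sum>k\<in>A. a k * F k (b(j := b j - 1))))
     = (\<Sum>k\<in>A. \<Sum>j<n. a k * ((1 - Q ^ b j) / Q ^ vsum (Suc j) b * F k (b(j := b j - 1))))"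
    unfolding sum_distrib_left by (subst sum.swap) (simp only: mult.left_commute)
  finally show ?thesis
    unfolding qdiff_def by (simp only: right_diff_distrib sum_subtractf sum_distrib_left sum_divide_distrib times_divide_eq_right)
qed

lemma Phi_op_sum:
  assumes "\<And>g. g \<le> b \<Longrightarrow> f g = (\<Sum>k\<in>A. a k * F k g)"
  shows "Phi_op n Q l m f b = (\<Sum>k\<in>A. a k * Phi_op n Q l m (F k) b)"
proof -
  have "Phi_op n Q l m f b = (\<Sum>g\<le>b. \<Sum>k\<in>A. a k * (Phi n Q g b l m * F k g))"
    unfolding Phi_op_def by (intro sum.cong refl) (simp add: assms sum_distrib_left mult_ac)
  also have "\<dots> = (\<Sum>k\<in>A. a k * Phi_op n Q l m (F k) b)"
    unfolding Phi_op_def by (subst sum.swap) (simp add: sum_distrib_left)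
  finally show ?thesis .
qed

text \<open>Comparing coefficients, only indices with \<open>vsum n k = d\<close> can occur in
  \<open>f\<close>, since the numbers \<open>1 / Q ^ vsum n k\<close> are distinct for distinct
  levels. On a single level averaging is multiplication by a scalar.\<close>

lemma Phi_op_qdiff_eigen:
  assumes Q: "0 < Q" "Q < 1" and m: "0 \<le> m" "m < 1" and l: "l \<noteq> 0"
    and ev: "\<And>b. b \<in> vecs n \<Longrightarrow> qdiff n Q f b = f b / Q ^ d" and b: "b \<in> vecs n"
  shows "Phi_op n Q l m f b = evalue Q l m d * f b"
proof -
  obtain a where a: "f b = (\<Sum>k\<in>{..b}. a k * efun n Q k b)" if "b \<in> vecs n" for b
    using efun_expansion[OF Q, of n f] by blast
  have ext: "f g = (\<Sum>k\<in>{..b}. a k * efun n Q k g)" if "b \<in> vecs n" "g \<le> b" for g b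
    using a[of g] that vecs_le[of g b] efun_sum_extend[of g b n] by simp
  have "a k * (1 / Q ^ vsum n k - 1 / Q ^ d) = 0" if "k \<in> vecs n" for k
  proof (rule efun_independent[OF Q _ that])
    fix b assume b: "b \<in> vecs n"
    have "(\<Sum>k\<in>{..b}. a k * (1 / Q ^ vsum n k - 1 / Q ^ d) * efun n Q k b)
       = (\<Sum>k\<in>{..b}. a k * (efun n Q k b / Q ^ vsum n k)) - f b / Q ^ d"
      unfolding a[OF b] sum_divide_distrib sum_subtractf[symmetric]
      by (intro sum.cong refl) (simp add: algebra_simps)
    also have "(\<Sum>k\<in>{..b}. a k * (efun n Q k b / Q ^ vsum n k)) = qdiff n Q f b"
      by (subst qdiff_sum[of b f a "efun n Q" "{..b}"])
        (auto simp: ext[OF b] qdiff_efun[OF Q(1) b vecs_le[OF _ b]])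
    finally show "(\<Sum>k\<in>{..b}. a k * (1 / Q ^ vsum n k - 1 / Q ^ d) * efun n Q k b) = 0"
      using ev[OF b] by simp
  qed
  moreover have "vsum n k = d" if "1 / Q ^ vsum n k - 1 / Q ^ d = 0" for k
  proof -
    have "Q ^ vsum n k = Q ^ d" using that Q by simp
    then show ?thesis using Q power_inject_exp'[of Q] by simp
  qed
  ultimately have c: "a k * evalue Q l m (vsum n k) = evalue Q l m d * a k" if "k \<in> vecs n" for k
    using that by (metis mult.commute mult_eq_0_iff)
  have "Phi_op n Q l m f b = (\<Sum>k\<in>{..b}. a k * (evalue Q l m (vsum n k) * efun n Q k b))"
    by (subst Phi_op_sum[of b f a "efun n Q" "{..b}"])
      (auto simp: ext[OF b] Phi_op_efun[OF Q m l b vecs_le[OF _ b]])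
  also have "\<dots> = evalue Q l m d * f b"
    unfolding a[OF b] sum_distrib_left
  proof (rule sum.cong[OF refl])
    fix k assume "k \<in> {..b}"
    then have "a k * evalue Q l m (vsum n k) = evalue Q l m d * a k"
      using c vecs_le[OF _ b] by simp
    then show "a k * (evalue Q l m (vsum n k) * efun n Q k b) = evalue Q l m d * (a k * efun n Q k b)"
      by (simp only: mult.assoc[symmetric])
  qed
  finally show ?thesis .
qed

text \<open>Expand \<open>f b y\<close> in the variable \<open>b\<close>, with coefficients
  \<open>a y k\<close>. The symmetry \<open>qd\<close> makes each coefficient, as a function of
  \<open>y\<close>, an eigenfunction of \<open>qdiff\<close> with the eigenvalue of
  \<open>efun n Q k\<close>. Averaging then multiplies both by the same
  \<open>evalue\<close>.\<close>

lemma Phi_op_duality: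
  assumes Q: "0 < Q" "Q < 1" and m: "0 \<le> m" "m < 1" and l: "l \<noteq> 0"
    and qd: "\<And>b y. b \<in> vecs n \<Longrightarrow> y \<in> vecs n \<Longrightarrow> qdiff n Q (\<lambda>g. f g y) b = qdiff n Q (f b) y"
    and b: "b \<in> vecs n" and y: "y \<in> vecs n"
  shows "Phi_op n Q l m (\<lambda>g. f g y) b = Phi_op n Q l m (f b) y"
proof -
  have "\<exists>a. \<forall>b\<in>vecs n. f b y = (\<Sum>k\<in>{..b}. a k * efun n Q k b)" for y
    using efun_expansion[OF Q, of n "\<lambda>b. f b y"] by blast
  then obtain a where a: "f b y = (\<Sum>k\<in>{..b}. a y k * efun n Q k b)" if "b \<in> vecs n" for b y
    by metis
  have ext: "f g y = (\<Sum>k\<in>{..b}. a y k * efun n Q k g)" if "b \<in> vecs n" "g \<le> b" for g b y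
    using a[of g y] that vecs_le[of g b] efun_sum_extend[of g b n "a y" Q] by simp
  have ev: "qdiff n Q (\<lambda>y. a y k) y = a y k / Q ^ vsum n k" if "y \<in> vecs n" "k \<in> vecs n" for y k
  proof -
    have "qdiff n Q (\<lambda>y. a y k) y - a y k / Q ^ vsum n k = 0"
    proof (rule efun_independent[OF Q _ that(2)])
      fix b assume b: "b \<in> vecs n"
      \<comment> \<open>Here the roles are exchanged: the numbers \<open>efun n Q k b\<close> serve
        as coefficients, and the operator acts on the coefficient functions in
        \<open>y\<close>.\<close>
      have "qdiff n Q (f b) y = (\<Sum>k\<in>{..b}. efun n Q k b * qdiff n Q (\<lambda>y. a y k) y)"
        by (rule qdiff_sum) (simp add: a[OF b] mult.commute)
      moreover have "qdiff n Q (\<lambda>g. f g y) b = (\<Sum>k\<in>{..b}. a y k * (efun n Q k b / Q ^ vsum n k))"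
        by (subst qdiff_sum[of b _ "a y" "efun n Q" "{..b}"])
          (auto simp: ext[OF b] qdiff_efun[OF Q(1) b vecs_le[OF _ b]])
      ultimately have "(\<Sum>k\<in>{..b}. efun n Q k b * qdiff n Q (\<lambda>y. a y k) y)
          - (\<Sum>k\<in>{..b}. a y k * (efun n Q k b / Q ^ vsum n k)) = 0"
        using qd[OF b that(1)] by simp
      then show "(\<Sum>k\<in>{..b}. (qdiff n Q (\<lambda>y. a y k) y - a y k / Q ^ vsum n k) * efun n Q k b) = 0"
        unfolding sum_subtractf[symmetric] by (simp add: algebra_simps)
    qed
    then show ?thesis by simp
  qed
  have "Phi_op n Q l m (\<lambda>g. f g y) b = (\<Sum>k\<in>{..b}. a y k * (evalue Q l m (vsum n k) * efun n Q k b))"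
    by (subst Phi_op_sum[of b _ "a y" "efun n Q" "{..b}"])
      (auto simp: ext[OF b] Phi_op_efun[OF Q m l b vecs_le[OF _ b]])
  also have "\<dots> = (\<Sum>k\<in>{..b}. efun n Q k b * Phi_op n Q l m (\<lambda>y. a y k) y)"
    by (intro sum.cong refl, subst Phi_op_qdiff_eigen[OF Q m l ev y])
      (auto simp: vecs_le[OF _ b])
  also have "\<dots> = Phi_op n Q l m (f b) y"
    by (rule Phi_op_sum[symmetric]) (simp add: a[OF b] mult.commute)
  finally show ?thesis .
qed

section \<open>Duality on a single bond\<close>

text \<open>Species \<open>i\<close> of the first configuration is paired with species \<open>n - 1 - i\<close> of the second.\<close>

definition bond :: "nat \<Rightarrow> real \<Rightarrow> (nat \<Rightarrow> real) \<Rightarrow> (nat \<Rightarrow> nat) \<Rightarrow> (nat \<Rightarrow> nat) \<Rightarrow> real" where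
  "bond n Q z g y = Q ^ (\<Sum>i<n. \<Sum>j<n - 1 - i. g i * y j)
     * (\<Prod>i<n. qpoch (z i * Q) Q (g i + y (n - 1 - i))
          / (qpoch (z i * Q) Q (g i) * qpoch (z i * Q) Q (y (n - 1 - i))))"

lemma sum_triangle_swap:
  fixes f :: "nat \<Rightarrow> nat \<Rightarrow> 'a::comm_monoid_add"
  shows "(\<Sum>i<n. \<Sum>j<n - 1 - i. f i j) = (\<Sum>j<n. \<Sum>i<n - 1 - j. f i j)"
proof -
  have "(\<Sum>i<n. \<Sum>j<n - 1 - i. f i j) = (\<Sum>i<n. \<Sum>j<n. if i + j + 1 < n then f i j else 0)"
    by (intro sum.cong refl sum.mono_neutral_cong_left) auto
  also have "\<dots> = (\<Sum>j<n. \<Sum>i<n. if i + j + 1 < n then f i j else 0)"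
    by (rule sum.swap)
  also have "\<dots> = (\<Sum>j<n. \<Sum>i<n - 1 - j. f i j)"
    by (intro sum.cong refl sum.mono_neutral_cong_right) auto
  finally show ?thesis .
qed

text \<open>Reversing the species order maps the pairing of \<open>i\<close> with
  \<open>n - 1 - i\<close> to itself with the arguments exchanged, and the triangle of index pairs
  in the exponent is symmetric.\<close>

lemma bond_swap: "bond n Q z g y = bond n Q (\<lambda>i. z (n - 1 - i)) y g"
proof -
  have "(\<Sum>i<n. \<Sum>j<n - 1 - i. g i * y j) = (\<Sum>i<n. \<Sum>j<n - 1 - i. y i * g j)"
    by (subst sum_triangle_swap) (simp add: mult.commute)
  moreover have "(\<Prod>i<n. qpoch (z i * Q) Q (g i + y (n - 1 - i))
          / (qpoch (z i * Q) Q (g i) * qpoch (z i * Q) Q (y (n - 1 - i))))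
     = (\<Prod>i<n. qpoch (z (n - 1 - i) * Q) Q (y i + g (n - 1 - i))
          / (qpoch (z (n - 1 - i) * Q) Q (y i) * qpoch (z (n - 1 - i) * Q) Q (g (n - 1 - i))))"
    by (subst prod.nat_diff_reindex[symmetric], intro prod.cong refl) (simp add: add.commute mult.commute)
  ultimately show ?thesis by (simp add: bond_def)
qed

text \<open>Chosen so that \<open>1 - Q ^ g * bfac Q z g y\<close> equals
  \<open>(1 - Q ^ g) * (1 - z * Q ^ g) / (1 - z * Q ^ (g + y))\<close>, the factor that arises on
  removing one particle. In contrast to that factor, \<open>bfac\<close> is symmetric in
  \<open>g\<close> and \<open>y\<close>.\<close>

definition bfac :: "real \<Rightarrow> real \<Rightarrow> nat \<Rightarrow> nat \<Rightarrow> real" where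
  "bfac Q z g y = (1 + z - z * Q ^ y - z * Q ^ g) / (1 - z * Q ^ (g + y))"

lemma bond_remove:
  assumes Q: "0 < Q" and z: "\<And>k. z j * Q ^ k \<noteq> 1" and j: "j < n"
  shows "(1 - Q ^ g j) * bond n Q z (g(j := g j - 1)) y
     = bond n Q z g y * (1 - Q ^ g j * bfac Q (z j) (g j) (y (n - 1 - j))) / Q ^ vsum (n - 1 - j) y"
proof -
  define g' where "g' = g(j := g j - 1)"
  define B where "B = (\<lambda>i a. qpoch (z i * Q) Q (a + y (n - 1 - i))
          / (qpoch (z i * Q) Q a * qpoch (z i * Q) Q (y (n - 1 - i))))"
  define R where "R = (\<Prod>i\<in>{..<n} - {j}. B i (g i))"
  have pg: "(\<Prod>i<n. B i (g i)) = B j (g j) * R"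
    unfolding R_def using j by (subst prod.remove[of _ j]) auto
  have "(\<Prod>i\<in>{..<n} - {j}. B i (g' i)) = R"
    unfolding R_def by (intro prod.cong) (auto simp: g'_def)
  then have pg': "(\<Prod>i<n. B i (g' i)) = B j (g j - 1) * R"
    using j by (subst prod.remove[of _ j]) (auto simp: g'_def)
  have z1: "1 - z j * Q ^ k \<noteq> 0" for k using z[of k] by simp
  have nz: "qpoch (z j * Q) Q k \<noteq> 0" for k
    unfolding qpoch_def using z[of "Suc _"] by (simp add: mult.assoc)
  have bf: "1 - Q ^ a * bfac Q (z j) a b = (1 - Q ^ a) * (1 - z j * Q ^ a) / (1 - z j * Q ^ (a + b))" for a b
    using z1[of "a + b"] unfolding bfac_def
    by (simp add: divide_simps) (simp add: power_add algebra_simps)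
  show ?thesis
  proof (cases "g j")
    case 0
    then show ?thesis using bf[of 0] by simp
  next
    case (Suc a)
    define b where "b = y (n - 1 - j)"
    have "(\<Sum>l<n - 1 - i. g i * y l) = (\<Sum>l<n - 1 - i. g' i * y l) + (if i = j then vsum (n - 1 - j) y else 0)" for i
      using Suc by (auto simp: g'_def vsum_def sum.distrib)
    then have e: "(\<Sum>i<n. \<Sum>l<n - 1 - i. g i * y l) = (\<Sum>i<n. \<Sum>l<n - 1 - i. g' i * y l) + vsum (n - 1 - j) y"
      using j by (simp add: sum.distrib)
    have "B j (Suc a) = B j a * ((1 - z j * Q ^ (Suc a + b)) / (1 - z j * Q ^ Suc a))"
      unfolding B_def b_def[symmetric] by (simp add: qpoch_Suc mult_ac)
    then have B: "B j a = B j (Suc a) * ((1 - z j * Q ^ Suc a) / (1 - z j * Q ^ (Suc a + b)))"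
      using z1[of "Suc a"] z1[of "Suc a + b"] by (simp only: divide_simps) auto
    have bg: "bond n Q z h y = Q ^ (\<Sum>i<n. \<Sum>l<n - 1 - i. h i * y l) * (\<Prod>i<n. B i (h i))" for h
      by (simp add: bond_def B_def)
    have "(1 - Q ^ g j) * bond n Q z g' y
       = (1 - Q ^ Suc a) * (Q ^ (\<Sum>i<n. \<Sum>l<n - 1 - i. g' i * y l) * (B j a * R))"
      unfolding bg pg' Suc by simp
    also have "\<dots> = Q ^ (\<Sum>i<n. \<Sum>l<n - 1 - i. g' i * y l) * (B j (Suc a) * R)
       * ((1 - Q ^ Suc a) * (1 - z j * Q ^ Suc a) / (1 - z j * Q ^ (Suc a + b)))"
      unfolding B by (simp only: times_divide_eq_right times_divide_eq_left mult_ac)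
    also have "\<dots> = bond n Q z g y * (1 - Q ^ g j * bfac Q (z j) (g j) b) / Q ^ vsum (n - 1 - j) y"
      unfolding bg pg e bf Suc power_add[of Q _ "vsum (n - 1 - j) y"] using Q by simp
    finally show ?thesis by (simp add: g'_def b_def)
  qed
qed

text \<open>The multiplier by which \<open>qdiff\<close> acts on \<open>bond\<close>. The second
  term cancels the summand \<open>a = 0\<close>; with that summand included, the sum over
  \<open>a\<close> is invariant under \<open>a \<mapsto> n - a\<close> together with the exchange of
  arguments.\<close>

definition bond_ev :: "nat \<Rightarrow> real \<Rightarrow> (nat \<Rightarrow> real) \<Rightarrow> (nat \<Rightarrow> nat) \<Rightarrow> (nat \<Rightarrow> nat) \<Rightarrow> real" where
  "bond_ev n Q z g y = 1 / Q ^ vsum n g + 1 / Q ^ vsum n y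
     - (\<Sum>a\<le>n. 1 / (Q ^ vsum a g * Q ^ vsum (n - a) y))
     + (\<Sum>j<n. bfac Q (z j) (g j) (y (n - 1 - j)) / (Q ^ vsum j g * Q ^ vsum (n - 1 - j) y))"

lemma bond_ev_swap: "bond_ev n Q z g y = bond_ev n Q (\<lambda>i. z (n - 1 - i)) y g"
proof -
  have "(\<Sum>a\<le>n. 1 / (Q ^ vsum a g * Q ^ vsum (n - a) y)) = (\<Sum>a\<le>n. 1 / (Q ^ vsum a y * Q ^ vsum (n - a) g))"
    using sum.atLeastAtMost_rev[of "\<lambda>a. 1 / (Q ^ vsum a g * Q ^ vsum (n - a) y)" 0 n]
    by (simp add: atMost_atLeast0 mult.commute)
  moreover have "bfac Q z a b = bfac Q z b a" for z a b
    by (simp add: bfac_def add.commute algebra_simps)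
  then have "(\<Sum>j<n. bfac Q (z j) (g j) (y (n - 1 - j)) / (Q ^ vsum j g * Q ^ vsum (n - 1 - j) y))
     = (\<Sum>j<n. bfac Q (z (n - 1 - j)) (y j) (g (n - 1 - j)) / (Q ^ vsum j y * Q ^ vsum (n - 1 - j) g))"
    by (subst sum.nat_diff_reindex[symmetric]) (intro sum.cong refl, simp add: mult.commute)
  ultimately show ?thesis by (simp add: bond_ev_def)
qed

text \<open>In the removal term for species \<open>j\<close>, the power \<open>Q ^ g j\<close> in
  front of \<open>bfac\<close> cancels the last species in \<open>vsum (Suc j) g\<close>. This
  leaves \<open>vsum j g\<close> and \<open>vsum (n - 1 - j) y\<close>, which are exchanged under
  the reversal of species.\<close>

lemma qdiff_bond:
  assumes Q: "0 < Q" and z: "\<And>j k. z j * Q ^ k \<noteq> 1"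
  shows "qdiff n Q (\<lambda>g. bond n Q z g y) g = bond n Q z g y * bond_ev n Q z g y"
proof -
  define s where "s = (\<lambda>j. bfac Q (z j) (g j) (y (n - 1 - j)))"
  have t: "(1 - Q ^ g j) / Q ^ vsum (Suc j) g * bond n Q z (g(j := g j - 1)) y
     = bond n Q z g y * (1 / (Q ^ vsum (Suc j) g * Q ^ vsum (n - Suc j) y) - s j / (Q ^ vsum j g * Q ^ vsum (n - 1 - j) y))"
    if "j < n" for j
  proof -
    have "(1 - Q ^ g j) / Q ^ vsum (Suc j) g * bond n Q z (g(j := g j - 1)) y
      = bond n Q z g y * (1 - Q ^ g j * s j) / Q ^ vsum (n - 1 - j) y / Q ^ vsum (Suc j) g"
      using bond_remove[OF Q, of z j n g y, OF z that] by (simp add: s_def)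
    also have "\<dots> = bond n Q z g y * (1 / (Q ^ vsum (Suc j) g * Q ^ vsum (n - Suc j) y) - s j / (Q ^ vsum j g * Q ^ vsum (n - 1 - j) y))"
      using Q by (simp add: vsum_Suc power_add field_simps)
    finally show ?thesis .
  qed
  have "(\<Sum>a\<le>n. 1 / (Q ^ vsum a g * Q ^ vsum (n - a) y))
     = 1 / Q ^ vsum n y + (\<Sum>j<n. 1 / (Q ^ vsum (Suc j) g * Q ^ vsum (n - Suc j) y))"
    by (simp add: sum.atMost_shift vsum_def)
  moreover have "qdiff n Q (\<lambda>g. bond n Q z g y) g
     = bond n Q z g y * (1 / Q ^ vsum n g) - (\<Sum>j<n. bond n Q z g y *
     (1 / (Q ^ vsum (Suc j) g * Q ^ vsum (n - Suc j) y) - s j / (Q ^ vsum j g * Q ^ vsum (n - 1 - j) y)))"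
    using sum.cong[OF refl, of "{..<n}", OF t] unfolding qdiff_def by simp
  ultimately show ?thesis
    unfolding sum_distrib_left[symmetric] sum_subtractf bond_ev_def
    by (simp add: algebra_simps s_def)
qed

text \<open>Applying \<open>qdiff\<close> in either argument multiplies \<open>bond\<close> by the
  same function, by \<open>bond_swap\<close> and \<open>bond_ev_swap\<close>; this is the hypothesis
  \<open>qd\<close> of \<open>Phi_op_duality\<close>.\<close>

lemma Phi_op_bond:
  assumes Q: "0 < Q" "Q < 1" and m: "0 \<le> m" "m < 1" and l: "l \<noteq> 0"
    and z: "\<And>j k. z j * Q ^ k \<noteq> 1"
    and b: "b \<in> vecs n" and y: "y \<in> vecs n"
  shows "Phi_op n Q l m (\<lambda>g. bond n Q z g y) b = Phi_op n Q l m (bond n Q z b) y"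
proof (rule Phi_op_duality[OF Q m l _ b y])
  fix b y :: "nat \<Rightarrow> nat"
  have "qdiff n Q (bond n Q z b) y = qdiff n Q (\<lambda>y. bond n Q (\<lambda>i. z (n - 1 - i)) y b) y"
    by (rule arg_cong[where f = "\<lambda>f. qdiff n Q f y"], rule ext, rule bond_swap)
  also have "\<dots> = bond n Q z b y * bond_ev n Q z b y"
    unfolding qdiff_bond[OF Q(1) z] bond_swap[of n Q z b y, symmetric] bond_ev_swap[of n Q z b y, symmetric] ..
  finally show "qdiff n Q (\<lambda>g. bond n Q z g y) b = qdiff n Q (bond n Q z b) y"
    unfolding qdiff_bond[OF Q(1) z] ..
qed

section \<open>The duality function under jumps\<close>

text \<open>The Pochhammer symbol of \<open>1/q\<close> in base \<open>1/q^2\<close>. The symbols in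
  \<open>Dual\<close> are quotients of its values, which allows regrouping the product over sites
  into one over bonds.\<close>

definition Ffac :: "real \<Rightarrow> nat \<Rightarrow> real" where
  "Ffac q a = (\<Prod>j<a. 1 - q powi (- 1 - 2 * int j))"

text \<open>All exponents arising from \<open>Dual\<close> are odd, thanks to the \<open>+ 1\<close>
  in its bases. Hence none of the factors or denominators below vanishes.\<close>

lemma powi_odd_neq_1:
  assumes "0 < q" "q < (1::real)" "odd k"
  shows "q powi k \<noteq> 1"
proof
  assume *: "q powi k = 1"
  have "k \<noteq> 0" using assms(3) by auto
  then have "nat \<bar>k\<bar> \<noteq> 0" by simp
  then have "q ^ nat \<bar>k\<bar> < 1" using assms by (simp add: power_less_one_iff)
  moreover have "q ^ nat \<bar>k\<bar> = 1"
    using * assms(1) by (cases "k \<ge> 0") (auto simp: power_int_def power_inverse)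
  ultimately show False by simp
qed

lemma Ffac_nonzero: "0 < q \<Longrightarrow> q < 1 \<Longrightarrow> Ffac q a \<noteq> 0"
  unfolding Ffac_def using powi_odd_neq_1[of q] by simp

text \<open>In reverse order the factors on the left are the top \<open>k\<close> factors of
  \<open>Ffac q a\<close>.\<close>

lemma qpoch_Ffac:
  assumes q: "0 < q" "q < 1" and "k \<le> a"
  shows "qpoch (q powi (- 2 * int a + 1)) (q\<^sup>2) k = Ffac q a / Ffac q (a - k)"
  using assms(3)
proof (induction k)
  case 0
  then show ?case using Ffac_nonzero[OF q] by simp
next
  case (Suc k)
  obtain d where d: "a = Suc (k + d)" using Suc.prems less_imp_Suc_add by (auto simp: Suc_le_eq)
  have p: "q powi (- 2 * int a + 1) * (q\<^sup>2) ^ k = q powi (- 1 - 2 * int d)"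
  proof -
    have "(q\<^sup>2) ^ k = q powi (2 * int k)"
      by (metis of_nat_mult of_nat_numeral power_int_of_nat power_mult)
    then have "q powi (- 2 * int a + 1) * (q\<^sup>2) ^ k = q powi (- 2 * int a + 1 + 2 * int k)"
      using q by (simp add: power_int_add)
    also have "- 2 * int a + 1 + 2 * int k = - 1 - 2 * int d" by (simp add: d)
    finally show ?thesis .
  qed
  have "Ffac q (Suc d) = Ffac q d * (1 - q powi (- 1 - 2 * int d))" by (simp add: Ffac_def)
  moreover have "1 - q powi (- 1 - 2 * int d) \<noteq> 0" using powi_odd_neq_1[OF q, of "- 1 - 2 * int d"] by simp
  ultimately show ?case
    using Suc Ffac_nonzero[OF q] unfolding qpoch_Suc p by (simp add: d)
qed

text \<open>Normalised so that \<open>bond_z q a * q\<^sup>2\<close> is the base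
  \<open>q powi (- 2 * int a + 1)\<close> occurring in \<open>Dual\<close>.\<close>

definition bond_z :: "real \<Rightarrow> nat \<Rightarrow> real" where
  "bond_z q a = q powi (- 1 - 2 * int a)"

lemma bond_z_neq:
  assumes q: "0 < q" "q < 1"
  shows "bond_z q a * (q\<^sup>2) ^ k \<noteq> 1"
proof -
  have "(q\<^sup>2) ^ k = q powi (2 * int k)"
    by (metis of_nat_mult of_nat_numeral power_int_of_nat power_mult)
  then have "bond_z q a * (q\<^sup>2) ^ k = q powi (- 1 - 2 * int a + 2 * int k)"
    using q by (simp add: power_int_add bond_z_def)
  then show ?thesis using powi_odd_neq_1[OF q, of "- 1 - 2 * int a + 2 * int k"] by simp
qed

text \<open>By \<open>qpoch_Ffac\<close> each symbol on the right is a quotient of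
  \<open>Ffac q a\<close>, and everything else cancels. This is the effect of lowering
  \<open>a\<close> by \<open>g\<close> in a quotient of step \<open>y\<close>.\<close>

lemma Ffac_bond:
  assumes q: "0 < q" "q < 1" and le: "g + y \<le> a"
  shows "Ffac q (a - g) / Ffac q (a - g - y) = Ffac q a / Ffac q (a - y) *
     (qpoch (bond_z q a * q\<^sup>2) (q\<^sup>2) (g + y) /
      (qpoch (bond_z q a * q\<^sup>2) (q\<^sup>2) g * qpoch (bond_z q a * q\<^sup>2) (q\<^sup>2) y))"
proof -
  have "bond_z q a * q\<^sup>2 = q powi (- 1 - 2 * int a + 2)"
    using q power_int_add[of q "- 1 - 2 * int a" 2] by (simp add: bond_z_def)
  then have z: "bond_z q a * q\<^sup>2 = q powi (- 2 * int a + 1)" by (simp add: algebra_simps)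
  have "g \<le> a" "y \<le> a" using le by auto
  then show ?thesis
    unfolding z qpoch_Ffac[OF q le] qpoch_Ffac[OF q \<open>g \<le> a\<close>] qpoch_Ffac[OF q \<open>y \<le> a\<close>]
    using Ffac_nonzero[OF q] by (simp add: divide_simps)
qed

section \<open>Partial sums and species-wise factors under moves to the right and to the
  left\<close>

lemma Nminus_Suc: "Nminus (Suc x) u = Nminus x u + u (Suc x)"
  by (simp add: Nminus_def)

lemma Nminus_0 [simp]: "Nminus 0 u = 0"
  by (simp add: Nminus_def)

lemma Nplus_eq: "x \<le> L \<Longrightarrow> Nplus L x v = v x + Nplus L (Suc x) v"
  by (simp add: Nplus_def sum.atLeast_Suc_atMost)

lemma Nplus_beyond [simp]: "L < x \<Longrightarrow> Nplus L x v = 0"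
  by (simp add: Nplus_def)

text \<open>\<open>c x\<close> is the flux across the bond from \<open>x\<close> to
  \<open>x + 1\<close>, so the mass up to \<open>x\<close> drops by exactly this amount.\<close>

lemma Nminus_right:
  assumes "c \<le> u" "c 0 = 0"
  shows "Nminus x (\<lambda>x. u x - c x + c (x - 1)) + c x = Nminus x u"
proof (induction x)
  case (Suc x)
  then show ?case using le_funD[OF assms(1), of "Suc x"] by (simp add: Nminus_Suc)
qed (simp add: assms)

lemma Nplus_right:
  assumes "c \<le> u" "c L = 0" "1 \<le> x" "x \<le> Suc L"
  shows "Nplus L x (\<lambda>x. u x - c x + c (x - 1)) = Nplus L x u + c (x - 1)"
  using assms(4,3)
proof (induction rule: inc_induct)
  case base
  then show ?case using assms by simp
next
  case (step x)
  then show ?case using le_funD[OF assms(1), of x] by (simp add: Nplus_eq)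
qed

lemma Nplus_left:
  assumes "c \<le> v" "c (Suc L) = 0" "x \<le> Suc L"
  shows "Nplus L x (\<lambda>x. v x - c x + c (x + 1)) + c x = Nplus L x v"
  using assms(3)
proof (induction rule: inc_induct)
  case base
  then show ?case using assms by simp
next
  case (step x)
  then show ?case using le_funD[OF assms(1), of x] by (simp add: Nplus_eq)
qed

definition Dfac :: "nat \<Rightarrow> real \<Rightarrow> (nat \<Rightarrow> nat) \<Rightarrow> (nat \<Rightarrow> nat) \<Rightarrow> real" where
  "Dfac L q u v = (\<Prod>x\<in>{1..L}. qpoch (q powi (- 2 * int (Nminus x u + Nplus L (x + 1) v) + 1)) (q\<^sup>2) (u x))"

lemma Dfac_Ffac:
  assumes q: "0 < q" "q < 1"
  shows "Dfac L q u v = (\<Prod>x\<in>{1..L}. Ffac q (Nminus x u + Nplus L (x + 1) v)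
     / Ffac q (Nminus (x - 1) u + Nplus L (x + 1) v))"
  unfolding Dfac_def
proof (rule prod.cong[OF refl])
  fix x assume x: "x \<in> {1..L}"
  then have "Nminus x u = Nminus (x - 1) u + u x"
    by (cases x) (auto simp: Nminus_Suc)
  then show "qpoch (q powi (- 2 * int (Nminus x u + Nplus L (x + 1) v) + 1)) (q\<^sup>2) (u x)
     = Ffac q (Nminus x u + Nplus L (x + 1) v) / Ffac q (Nminus (x - 1) u + Nplus L (x + 1) v)"
    by (subst qpoch_Ffac[OF q]) auto
qed

text \<open>Two ways of distributing the factors over the bonds \<open>(x, x + 1)\<close>: the first isolates
  the effect of moving \<open>u\<close>, the second that of moving \<open>v\<close>.\<close>

lemma Dfac_bonds_right:
  assumes q: "0 < q" "q < 1" and L: "1 \<le> L"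
  shows "Dfac L q u v = Ffac q (Nminus L u) / Ffac q (Nplus L 2 v) *
    (\<Prod>x\<in>{1..<L}. Ffac q (Nminus x u + Nplus L (x + 1) v) / Ffac q (Nminus x u + Nplus L (x + 2) v))"
proof -
  obtain K where K: "L = Suc K" using L by (cases L) auto
  have "(\<Prod>x\<in>{1..L}. Ffac q (Nminus (x - 1) u + Nplus L (x + 1) v))
      = (\<Prod>x\<in>{0..K}. Ffac q (Nminus x u + Nplus L (x + 2) v))"
    unfolding K One_nat_def by (subst prod.shift_bounds_cl_Suc_ivl) simp
  also have "\<dots> = Ffac q (Nplus L 2 v) * (\<Prod>x\<in>{1..<L}. Ffac q (Nminus x u + Nplus L (x + 2) v))"
    unfolding K by (simp add: prod.atLeast_Suc_atMost atLeastLessThanSuc_atLeastAtMost numeral_2_eq_2)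
  finally have d: "(\<Prod>x\<in>{1..L}. Ffac q (Nminus (x - 1) u + Nplus L (x + 1) v))
      = Ffac q (Nplus L 2 v) * (\<Prod>x\<in>{1..<L}. Ffac q (Nminus x u + Nplus L (x + 2) v))" .
  have n: "(\<Prod>x\<in>{1..L}. Ffac q (Nminus x u + Nplus L (x + 1) v))
      = Ffac q (Nminus L u) * (\<Prod>x\<in>{1..<L}. Ffac q (Nminus x u + Nplus L (x + 1) v))"
    unfolding K by (simp add: atLeastLessThanSuc_atLeastAtMost mult.commute)
  show ?thesis
    unfolding Dfac_Ffac[OF q] prod_dividef d n by simp
qed

lemma Dfac_bonds_left:
  assumes q: "0 < q" "q < 1" and L: "1 \<le> L"
  shows "Dfac L q u v = Ffac q (Nminus L u) / Ffac q (Nminus (L - 1) u) *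
    (\<Prod>x\<in>{1..<L}. Ffac q (Nminus x u + Nplus L (x + 1) v) / Ffac q (Nminus (x - 1) u + Nplus L (x + 1) v))"
proof -
  obtain K where K: "L = Suc K" using L by (cases L) auto
  show ?thesis
    unfolding Dfac_Ffac[OF q] unfolding K
    by (simp add: atLeastLessThanSuc_atLeastAtMost mult.commute)
qed

definition bond_fac :: "real \<Rightarrow> nat \<Rightarrow> nat \<Rightarrow> nat \<Rightarrow> real" where
  "bond_fac q a g y = qpoch (bond_z q a * q\<^sup>2) (q\<^sup>2) (g + y) /
      (qpoch (bond_z q a * q\<^sup>2) (q\<^sup>2) g * qpoch (bond_z q a * q\<^sup>2) (q\<^sup>2) y)"

text \<open>In the grouping of \<open>Dfac_bonds_right\<close>, a bond contains \<open>u\<close>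
  only through \<open>Nminus x u\<close>, which drops by \<open>c x\<close>;
  \<open>Ffac_bond\<close> gives the change. The prefactor contains only the total of
  \<open>u\<close>, preserved since \<open>c L = 0\<close>.\<close>

lemma Dfac_right:
  assumes q: "0 < q" "q < 1" and L: "1 \<le> L" and c: "c \<le> u" "c 0 = 0" "c L = 0"
  shows "Dfac L q (\<lambda>x. u x - c x + c (x - 1)) v = Dfac L q u v *
    (\<Prod>x\<in>{1..<L}. bond_fac q (Nminus x u + Nplus L (x + 1) v) (c x) (v (x + 1)))"
proof -
  let ?u = "\<lambda>x. u x - c x + c (x - 1)"
  have N: "Nminus x ?u = Nminus x u - c x" for x
    using Nminus_right[OF c(1,2), of x] by linarith
  have "Ffac q (Nminus x ?u + Nplus L (x + 1) v) / Ffac q (Nminus x ?u + Nplus L (x + 2) v)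
      = Ffac q (Nminus x u + Nplus L (x + 1) v) / Ffac q (Nminus x u + Nplus L (x + 2) v)
      * bond_fac q (Nminus x u + Nplus L (x + 1) v) (c x) (v (x + 1))" if x: "x \<in> {1..<L}" for x
  proof -
    have cx: "c x \<le> Nminus x u"
      using Nminus_right[OF c(1,2), of x] by linarith
    have Y: "Nplus L (x + 1) v = v (x + 1) + Nplus L (x + 2) v"
      using x Nplus_eq[of "x + 1" L v] by simp
    show ?thesis
      using Ffac_bond[OF q, of "c x" "v (x + 1)" "Nminus x u + Nplus L (x + 1) v"] cx
      unfolding N bond_fac_def Y by simp
  qed
  then show ?thesis
    unfolding Dfac_bonds_right[OF q L] N[of L] c(3)
    by (simp add: prod.distrib[symmetric])
qed

text \<open>The mirror argument: a bond now contains \<open>v\<close> only through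
  \<open>Nplus L (x + 1) v\<close>, which drops by \<open>c (x + 1)\<close>. The first argument of
  \<open>bond_fac\<close> is the same as for moves to the right, so both moves share one function
  per bond.\<close>

lemma Dfac_left:
  assumes q: "0 < q" "q < 1" and L: "1 \<le> L" and c: "c \<le> v" "c (Suc L) = 0"
  shows "Dfac L q u (\<lambda>x. v x - c x + c (x + 1)) = Dfac L q u v *
    (\<Prod>x\<in>{1..<L}. bond_fac q (Nminus x u + Nplus L (x + 1) v) (u x) (c (x + 1)))"
proof -
  let ?v = "\<lambda>x. v x - c x + c (x + 1)"
  have "Ffac q (Nminus x u + Nplus L (x + 1) ?v) / Ffac q (Nminus (x - 1) u + Nplus L (x + 1) ?v)
      = Ffac q (Nminus x u + Nplus L (x + 1) v) / Ffac q (Nminus (x - 1) u + Nplus L (x + 1) v)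
      * bond_fac q (Nminus x u + Nplus L (x + 1) v) (u x) (c (x + 1))" if x: "x \<in> {1..<L}" for x
  proof -
    have N: "Nplus L (x + 1) v = Nplus L (x + 1) ?v + c (x + 1)"
      using Nplus_left[OF c, of "x + 1"] x by simp
    have X: "Nminus x u = Nminus (x - 1) u + u x"
      using x by (cases x) (auto simp: Nminus_Suc)
    have "bond_fac q a g y = bond_fac q a y g" for a g y
      by (simp add: bond_fac_def add.commute mult.commute)
    then show ?thesis
      using Ffac_bond[OF q, of "c (x + 1)" "u x" "Nminus x u + Nplus L (x + 1) v"]
      unfolding bond_fac_def[symmetric] unfolding N X by (simp add: add_ac)
  qed
  then show ?thesis
    unfolding Dfac_bonds_left[OF q L] by (simp add: prod.distrib[symmetric])
qed

section \<open>The exponent of \<open>q\<close> as a sum over pairs of species, and its change under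
  moves\<close>

definition Hpair :: "nat \<Rightarrow> (nat \<Rightarrow> nat) \<Rightarrow> (nat \<Rightarrow> nat) \<Rightarrow> int" where
  "Hpair L u v = (\<Sum>x\<in>{1..L}. - int (u x) * int (Nplus L (x + 1) v) + int (v x) * int (Nplus L x u))"

lemma Nplus_sum: "Nplus L x (\<lambda>y. \<Sum>j\<in>A. f j y) = (\<Sum>j\<in>A. Nplus L x (f j))"
  unfolding Nplus_def by (rule sum.swap)

lemma sum_swap3:
  "(\<Sum>x\<in>A. \<Sum>i\<in>B. \<Sum>j\<in>C i. f x i j) = (\<Sum>i\<in>B. \<Sum>j\<in>C i. \<Sum>x\<in>A. f x i j)"
  by (rule trans[OF sum.swap sum.cong[OF refl sum.swap]])

text \<open>The two kinds of terms in \<open>hexp\<close> run over the triangle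
  \<open>i + j < n - 1\<close> with the species roles exchanged; swapping the indices in the second
  kind aligns them.\<close>

lemma hexp_eq: "hexp n L \<xi> \<eta> = (\<Sum>i<n. \<Sum>j<n - 1 - i. Hpair L (\<lambda>x. \<xi> x i) (\<lambda>x. \<eta> x j))"
proof -
  have "hexp n L \<xi> \<eta> = (\<Sum>x\<in>{1..L}.
      (\<Sum>i<n. \<Sum>j<n - 1 - i. - int (\<xi> x i) * int (Nplus L (x + 1) (\<lambda>x. \<eta> x j))) +
      (\<Sum>i<n. \<Sum>j<n - 1 - i. int (\<eta> x i) * int (Nplus L x (\<lambda>x. \<xi> x j))))"
    unfolding hexp_def species_below_def Nplus_sum
    by (simp add: sum.distrib sum_distrib_left sum_subtractf sum_negf)
  also have "\<dots> = (\<Sum>x\<in>{1..L}. \<Sum>i<n. \<Sum>j<n - 1 - i. - int (\<xi> x i) * int (Nplus L (x + 1) (\<lambda>x. \<eta> x j))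
      + int (\<eta> x j) * int (Nplus L x (\<lambda>x. \<xi> x i)))"
    unfolding sum_triangle_swap[of "\<lambda>i j. int (\<eta> _ i) * int (Nplus L _ (\<lambda>x. \<xi> x j))"]
    by (simp only: sum.distrib)
  also have "\<dots> = (\<Sum>i<n. \<Sum>j<n - 1 - i. Hpair L (\<lambda>x. \<xi> x i) (\<lambda>x. \<eta> x j))"
    unfolding Hpair_def by (rule sum_swap3)
  finally show ?thesis .
qed

text \<open>Up to a telescoping term, both parts of \<open>Hpair\<close> contribute the same product
  for each bond. This is the origin of the factor 2, and so of the base \<open>q\<^sup>2\<close> in
  \<open>bond\<close>.\<close>

lemma Hpair_right:
  assumes c: "c \<le> u" "c 0 = 0" "c L = 0"
  shows "Hpair L (\<lambda>x. u x - c x + c (x - 1)) v = Hpair L u v + 2 * (\<Sum>x\<in>{1..<L}. int (c x) * int (v (x + 1)))"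
proof -
  \<comment> \<open>The current through the bond weighted by the \<open>v\<close>-mass to its right.
    Its differences telescope to boundary values, which vanish because
    \<open>c 0 = c L = 0\<close>.\<close>
  define T where "T = (\<lambda>x. int (c x) * int (Nplus L (x + 1) v))"
  have "Hpair L (\<lambda>x. u x - c x + c (x - 1)) v
    = (\<Sum>x\<in>{1..L}. (- int (u x) * int (Nplus L (x + 1) v) + int (v x) * int (Nplus L x u))
        + (2 * (int (c (x - 1)) * int (v x)) + (T x - T (x - 1))))"
    unfolding Hpair_def
  proof (rule sum.cong[OF refl])
    fix x assume x: "x \<in> {1..L}"
    have Nr: "Nplus L x (\<lambda>x. u x - c x + c (x - 1)) = Nplus L x u + c (x - 1)"
      using x by (intro Nplus_right[OF c(1,3)]) auto
    have Y: "Nplus L x v = v x + Nplus L (x + 1) v" using x by (simp add: Nplus_eq)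
    have ix: "int (u x - c x + c (x - 1)) = int (u x) - int (c x) + int (c (x - 1))"
      using le_funD[OF c(1), of x] by simp
    have T1: "T (x - 1) = int (c (x - 1)) * int (Nplus L x v)"
      using x by (simp add: T_def)
    show "- int (u x - c x + c (x - 1)) * int (Nplus L (x + 1) v)
        + int (v x) * int (Nplus L x (\<lambda>x. u x - c x + c (x - 1)))
      = (- int (u x) * int (Nplus L (x + 1) v) + int (v x) * int (Nplus L x u))
        + (2 * (int (c (x - 1)) * int (v x)) + (T x - T (x - 1)))"
      unfolding Nr ix T1 unfolding T_def Y by (simp add: algebra_simps)
  qed
  also have "\<dots> = Hpair L u v + 2 * (\<Sum>x\<in>{1..L}. int (c (x - 1)) * int (v x)) + (\<Sum>x\<in>{1..L}. T x - T (x - 1))"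
    by (simp add: Hpair_def sum.distrib sum_distrib_left)
  also have "(\<Sum>x\<in>{1..L}. T x - T (x - 1)) = 0"
  proof -
    have "(\<Sum>x\<in>{1..L}. T x - T (x - 1)) = T L - T 0"
      by (induction L) auto
    then show ?thesis using c by (simp add: T_def)
  qed
  also have "(\<Sum>x\<in>{1..L}. int (c (x - 1)) * int (v x)) = (\<Sum>x\<in>{0..<L}. int (c x) * int (v (x + 1)))"
    by (rule sum.reindex_bij_witness[of _ Suc "\<lambda>x. x - 1"]) auto
  also have "\<dots> = (\<Sum>x\<in>{1..<L}. int (c x) * int (v (x + 1)))"
    using c by (intro sum.mono_neutral_right) (auto simp: Suc_le_eq)
  finally show ?thesis by simp
qed

lemma Hpair_left:
  assumes c: "c \<le> v" "c 1 = 0" "c (Suc L) = 0"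
  shows "Hpair L u (\<lambda>x. v x - c x + c (x + 1)) = Hpair L u v + 2 * (\<Sum>x\<in>{1..<L}. int (u x) * int (c (x + 1)))"
proof -
  \<comment> \<open>Here the flux into \<open>x - 1\<close> is weighted by the \<open>u\<close>-mass
    from \<open>x\<close> on; the boundary values vanish because
    \<open>c 1 = c (Suc L) = 0\<close>.\<close>
  define T where "T = (\<lambda>x. int (c x) * int (Nplus L x u))"
  have "Hpair L u (\<lambda>x. v x - c x + c (x + 1))
    = (\<Sum>x\<in>{1..L}. (- int (u x) * int (Nplus L (x + 1) v) + int (v x) * int (Nplus L x u))
        + (2 * (int (u x) * int (c (x + 1))) + (T (Suc x) - T x)))"
    unfolding Hpair_def
  proof (rule sum.cong[OF refl])
    fix x assume x: "x \<in> {1..L}"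
    have Nr: "int (Nplus L (x + 1) (\<lambda>x. v x - c x + c (x + 1))) = int (Nplus L (x + 1) v) - int (c (x + 1))"
      using Nplus_left[OF c(1,3), of "x + 1"] x by simp
    have Y: "Nplus L x u = u x + Nplus L (x + 1) u" using x by (simp add: Nplus_eq)
    have ix: "int (v x - c x + c (x + 1)) = int (v x) - int (c x) + int (c (x + 1))"
      using le_funD[OF c(1), of x] by simp
    show "- int (u x) * int (Nplus L (x + 1) (\<lambda>x. v x - c x + c (x + 1)))
        + int (v x - c x + c (x + 1)) * int (Nplus L x u)
      = (- int (u x) * int (Nplus L (x + 1) v) + int (v x) * int (Nplus L x u))
        + (2 * (int (u x) * int (c (x + 1))) + (T (Suc x) - T x))"
      unfolding Nr ix T_def Y by (simp add: algebra_simps)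
  qed
  also have "\<dots> = Hpair L u v + 2 * (\<Sum>x\<in>{1..L}. int (u x) * int (c (x + 1))) + (\<Sum>x\<in>{1..L}. T (Suc x) - T x)"
    by (simp add: Hpair_def sum.distrib sum_distrib_left)
  also have "(\<Sum>x\<in>{1..L}. T (Suc x) - T x) = 0"
  proof -
    have "(\<Sum>x\<in>{1..L}. T (Suc x) - T x) = T (Suc L) - T 1"
      by (induction L) auto
    then show ?thesis using c by (simp add: T_def)
  qed
  also have "(\<Sum>x\<in>{1..L}. int (u x) * int (c (x + 1))) = (\<Sum>x\<in>{1..<L}. int (u x) * int (c (x + 1)))"
    using c by (intro sum.mono_neutral_right) (auto simp: not_less le_antisym)
  finally show ?thesis by simp
qed

text \<open>Evaluated at the configurations before the step, hence constant while averaging over the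
  jumping particles.\<close>

definition site_z :: "nat \<Rightarrow> nat \<Rightarrow> real \<Rightarrow> config \<Rightarrow> config \<Rightarrow> nat \<Rightarrow> nat \<Rightarrow> real" where
  "site_z n L q \<xi> \<eta> x i = bond_z q (Nminus x (\<lambda>y. \<xi> y i) + Nplus L (x + 1) (\<lambda>y. \<eta> y (n - 1 - i)))"

lemma Dual_eq: "Dual n L q \<xi> \<eta> = q powi hexp n L \<xi> \<eta> * (\<Prod>i<n. Dfac L q (\<lambda>y. \<xi> y i) (\<lambda>y. \<eta> y (n - 1 - i)))"
  by (simp add: Dual_def Dfac_def)

lemma powi_hexp_bond:
  fixes q :: real
  assumes "0 < q"
  shows "q powi (h + 2 * (\<Sum>i<n. \<Sum>j<n - 1 - i. \<Sum>x\<in>A. int (g x i) * int (y x j)))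
    = q powi h * (\<Prod>x\<in>A. (q\<^sup>2) ^ (\<Sum>i<n. \<Sum>j<n - 1 - i. g x i * y x j))"
proof -
  have "(\<Sum>i<n. \<Sum>j<n - 1 - i. \<Sum>x\<in>A. int (g x i) * int (y x j))
     = int (\<Sum>x\<in>A. \<Sum>i<n. \<Sum>j<n - 1 - i. g x i * y x j)"
    unfolding of_nat_sum of_nat_mult
    by (rule sum_swap3[symmetric])
  then have "q powi (h + 2 * (\<Sum>i<n. \<Sum>j<n - 1 - i. \<Sum>x\<in>A. int (g x i) * int (y x j)))
     = q powi h * q powi (int (2 * (\<Sum>x\<in>A. \<Sum>i<n. \<Sum>j<n - 1 - i. g x i * y x j)))"
    using assms power_int_add[of q h] by simp
  also have "q powi (int (2 * (\<Sum>x\<in>A. \<Sum>i<n. \<Sum>j<n - 1 - i. g x i * y x j)))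
    = (\<Prod>x\<in>A. (q\<^sup>2) ^ (\<Sum>i<n. \<Sum>j<n - 1 - i. g x i * y x j))"
    unfolding power_int_of_nat power_mult power_sum ..
  finally show ?thesis .
qed

lemma Dual_move_right:
  assumes q: "0 < q" "q < 1" and L: "1 \<le> L" and c: "c \<le> \<xi>" "\<And>x. x \<notin> {1..<L} \<Longrightarrow> c x = (\<lambda>_. 0)"
  shows "Dual n L q (move_right \<xi> c) \<eta> = Dual n L q \<xi> \<eta> *
    (\<Prod>x\<in>{1..<L}. bond n (q\<^sup>2) (site_z n L q \<xi> \<eta> x) (c x) (\<eta> (x + 1)))"
proof -
  have ci: "(\<lambda>x. c x i) \<le> (\<lambda>x. \<xi> x i)" "c 0 i = 0" "c L i = 0" for i
    using c by (auto simp: le_fun_def)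
  have h: "hexp n L (move_right \<xi> c) \<eta> = hexp n L \<xi> \<eta>
     + 2 * (\<Sum>i<n. \<Sum>j<n - 1 - i. \<Sum>x\<in>{1..<L}. int (c x i) * int (\<eta> (x + 1) j))"
    unfolding hexp_eq move_right_def Hpair_right[OF ci] by (simp add: sum.distrib sum_distrib_left)
  have "(\<Prod>i<n. Dfac L q (\<lambda>y. move_right \<xi> c y i) (\<lambda>y. \<eta> y (n - 1 - i)))
     = (\<Prod>i<n. Dfac L q (\<lambda>y. \<xi> y i) (\<lambda>y. \<eta> y (n - 1 - i))) * (\<Prod>x\<in>{1..<L}. \<Prod>i<n.
        bond_fac q (Nminus x (\<lambda>y. \<xi> y i) + Nplus L (x + 1) (\<lambda>y. \<eta> y (n - 1 - i))) (c x i) (\<eta> (x + 1) (n - 1 - i)))"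
    unfolding move_right_def Dfac_right[OF q L ci] prod.distrib by (subst (2) prod.swap) simp
  then show ?thesis
    unfolding Dual_eq h powi_hexp_bond[OF q(1), where g = c and y = "\<lambda>x. \<eta> (x + 1)"] bond_def prod.distrib site_z_def bond_fac_def
    by simp
qed

lemma Dual_move_left:
  assumes q: "0 < q" "q < 1" and L: "1 \<le> L" and c: "c \<le> \<eta>" "\<And>x. x \<notin> {2..L} \<Longrightarrow> c x = (\<lambda>_. 0)"
  shows "Dual n L q \<xi> (move_left \<eta> c) = Dual n L q \<xi> \<eta> *
    (\<Prod>x\<in>{1..<L}. bond n (q\<^sup>2) (site_z n L q \<xi> \<eta> x) (\<xi> x) (c (x + 1)))"
proof -
  have ci: "(\<lambda>x. c x i) \<le> (\<lambda>x. \<eta> x i)" "c 1 i = 0" "c (Suc L) i = 0" for i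
    using c by (auto simp: le_fun_def)
  have h: "hexp n L \<xi> (move_left \<eta> c) = hexp n L \<xi> \<eta>
     + 2 * (\<Sum>i<n. \<Sum>j<n - 1 - i. \<Sum>x\<in>{1..<L}. int (\<xi> x i) * int (c (x + 1) j))"
    unfolding hexp_eq move_left_def Hpair_left[OF ci] by (simp add: sum.distrib sum_distrib_left)
  have "(\<Prod>i<n. Dfac L q (\<lambda>y. \<xi> y i) (\<lambda>y. move_left \<eta> c y (n - 1 - i)))
     = (\<Prod>i<n. Dfac L q (\<lambda>y. \<xi> y i) (\<lambda>y. \<eta> y (n - 1 - i))) * (\<Prod>x\<in>{1..<L}. \<Prod>i<n.
        bond_fac q (Nminus x (\<lambda>y. \<xi> y i) + Nplus L (x + 1) (\<lambda>y. \<eta> y (n - 1 - i))) (\<xi> x i) (c (x + 1) (n - 1 - i)))"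
    unfolding move_left_def Dfac_left[OF q L ci(1,3)] prod.distrib by (subst (2) prod.swap) simp
  then show ?thesis
    unfolding Dual_eq h powi_hexp_bond[OF q(1), where g = \<xi> and y = "\<lambda>x. c (x + 1)"] bond_def prod.distrib site_z_def bond_fac_def
    by simp
qed

section \<open>Duality of Markov chains and jump processes\<close>

lemma expectation_finite:
  fixes f :: "'a \<Rightarrow> real"
  assumes "finite S" "set_pmf p \<subseteq> S"
  shows "measure_pmf.expectation p f = (\<Sum>a\<in>S. pmf p a * f a)"
  using assms by (subst integral_measure_pmf_real[of S]) (auto simp: mult.commute)

lemma expectation_bind_finite:
  fixes h :: "'b \<Rightarrow> real"
  assumes "finite (set_pmf p)" "\<And>x. x \<in> set_pmf p \<Longrightarrow> finite (set_pmf (f x))"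
  shows "measure_pmf.expectation (bind_pmf p f) h
     = measure_pmf.expectation p (\<lambda>x. measure_pmf.expectation (f x) h)"
  using assms by (subst pmf_expectation_bind[of "set_pmf p"]) (auto simp: expectation_finite)

lemma expectation_swap_finite:
  fixes h :: "'a \<Rightarrow> 'b \<Rightarrow> real"
  assumes "finite (set_pmf p)" "finite (set_pmf r)"
  shows "measure_pmf.expectation p (\<lambda>a. measure_pmf.expectation r (h a))
     = measure_pmf.expectation r (\<lambda>b. measure_pmf.expectation p (\<lambda>a. h a b))"
  using assms
  by (simp add: expectation_finite[OF _ order_refl] sum_distrib_left, subst sum.swap) (simp add: mult.left_commute)

lemma expectation_diff_le:
  fixes f g :: "'a \<Rightarrow> real"
  assumes fin: "finite (set_pmf p)" and le: "\<And>x. x \<in> set_pmf p \<Longrightarrow> \<bar>f x - g x\<bar> \<le> e"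
  shows "\<bar>measure_pmf.expectation p f - measure_pmf.expectation p g\<bar> \<le> e"
proof -
  have "\<bar>measure_pmf.expectation p f - measure_pmf.expectation p g\<bar>
      = \<bar>\<Sum>a\<in>set_pmf p. pmf p a * (f a - g a)\<bar>"
    by (simp add: expectation_finite[OF fin order_refl] sum_subtractf right_diff_distrib)
  also have "\<dots> \<le> (\<Sum>a\<in>set_pmf p. \<bar>pmf p a * (f a - g a)\<bar>)" by (rule sum_abs)
  also have "\<dots> \<le> (\<Sum>a\<in>set_pmf p. pmf p a * e)"
    using le by (intro sum_mono) (simp add: abs_mult mult_left_mono)
  also have "\<dots> = e" by (simp add: sum_distrib_right[symmetric] sum_pmf_eq_1 fin)
  finally show ?thesis .
qed

lemma expectation_prod_Pi_pmf_finite: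
  fixes f :: "'a \<Rightarrow> 'b \<Rightarrow> real"
  assumes A: "finite A" and fin: "\<And>x. x \<in> A \<Longrightarrow> finite (set_pmf (p x))"
  shows "measure_pmf.expectation (Pi_pmf A d p) (\<lambda>c. \<Prod>x\<in>A. f x (c x))
     = (\<Prod>x\<in>A. measure_pmf.expectation (p x) (f x))"
proof -
  let ?B = "set_pmf \<circ> p"
  let ?h = "\<lambda>h x. if x \<in> A then h x else d"
  have inj: "inj_on ?h (PiE A ?B)"
  proof (rule inj_onI)
    fix g h assume *: "g \<in> PiE A ?B" "h \<in> PiE A ?B" "?h g = ?h h"
    show "g = h"
    proof (rule PiE_ext[OF *(1,2)])
      fix x assume "x \<in> A"
      then show "g x = h x" using fun_cong[OF *(3), of x] by simp
    qed
  qed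
  have "measure_pmf.expectation (Pi_pmf A d p) (\<lambda>c. \<Prod>x\<in>A. f x (c x))
     = (\<Sum>c\<in>PiE_dflt A d ?B. pmf (Pi_pmf A d p) c * (\<Prod>x\<in>A. f x (c x)))"
    using A fin by (intro expectation_finite finite_PiE_dflt) (auto simp: set_Pi_pmf)
  also have "\<dots> = (\<Sum>c\<in>PiE_dflt A d ?B. \<Prod>x\<in>A. pmf (p x) (c x) * f x (c x))"
    by (intro sum.cong refl) (subst pmf_Pi'[OF A], auto simp: PiE_dflt_def prod.distrib)
  also have "\<dots> = (\<Sum>c\<in>PiE A ?B. \<Prod>x\<in>A. pmf (p x) (c x) * f x (c x))"
    unfolding dflt_image_PiE[symmetric] sum.reindex[OF inj] by simp
  also have "\<dots> = (\<Prod>x\<in>A. \<Sum>y\<in>set_pmf (p x). pmf (p x) y * f x y)"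
    using A fin by (subst prod_sum_PiE[symmetric]) auto
  also have "\<dots> = (\<Prod>x\<in>A. measure_pmf.expectation (p x) (f x))"
    by (intro prod.cong refl) (simp add: expectation_finite[OF fin order_refl])
  finally show ?thesis .
qed

section \<open>Discrete-time chains with approximate one-step duality\<close>

lemma chain_law_Suc_left: "chain_law K (Suc t) s = bind_pmf (K s) (chain_law K t)"
proof (induction t)
  case 0
  have "chain_law K 0 = return_pmf" by (rule ext) simp
  then show ?case by (simp add: bind_return_pmf bind_return_pmf')
next
  case (Suc t)
  have "chain_law K (Suc (Suc t)) s = bind_pmf (bind_pmf (K s) (chain_law K t)) K"
    unfolding chain_law.simps(2)[of K "Suc t"] Suc.IH ..
  also have "\<dots> = bind_pmf (K s) (\<lambda>x. chain_law K (Suc t) x)"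
    by (simp add: bind_assoc_pmf)
  finally show ?case .
qed

lemma chain_law_closed:
  assumes "\<And>s. s \<in> S \<Longrightarrow> set_pmf (K s) \<subseteq> S \<and> finite (set_pmf (K s))" "s \<in> S"
  shows "set_pmf (chain_law K t s) \<subseteq> S \<and> finite (set_pmf (chain_law K t s))"
proof (induction t)
  case 0
  then show ?case using assms(2) by simp
next
  case (Suc t)
  have "finite (set_pmf (K u))" "set_pmf (K u) \<subseteq> S" if "u \<in> set_pmf (chain_law K t s)" for u
    using Suc.IH assms(1)[of u] that by blast+
  then show ?case using Suc.IH by (simp add: UN_subset_iff)
qed

text \<open>The last step of \<open>K\<close> is exchanged for the first step of \<open>K'\<close>,
  and the induction hypothesis covers the remaining steps. Each exchange costs \<open>e\<close>:
  discrete time uses \<open>e = 0\<close>, continuous time an error small compared with the step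
  length.\<close>

lemma chain_law_duality_approx:
  fixes D :: "'a \<Rightarrow> 'b \<Rightarrow> real"
  assumes K: "\<And>s. s \<in> S \<Longrightarrow> set_pmf (K s) \<subseteq> S \<and> finite (set_pmf (K s))"
    and K': "\<And>s. s \<in> S' \<Longrightarrow> set_pmf (K' s) \<subseteq> S' \<and> finite (set_pmf (K' s))"
    and step: "\<And>s s'. s \<in> S \<Longrightarrow> s' \<in> S' \<Longrightarrow>
      \<bar>measure_pmf.expectation (K s) (\<lambda>u. D u s') - measure_pmf.expectation (K' s') (D s)\<bar> \<le> e"
    and "s \<in> S" "s' \<in> S'"
  shows "\<bar>measure_pmf.expectation (chain_law K t s) (\<lambda>u. D u s')
     - measure_pmf.expectation (chain_law K' t s') (D s)\<bar> \<le> real t * e"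
  using assms(4,5)
proof (induction t arbitrary: s s')
  case 0
  then show ?case by simp
next
  case (Suc t)
  note c = chain_law_closed[of S K, OF K, of s t] and c' = chain_law_closed[of S' K', OF K']
  let ?p = "chain_law K t s"
  have 1: "measure_pmf.expectation (chain_law K (Suc t) s) (\<lambda>u. D u s')
     = measure_pmf.expectation ?p (\<lambda>a. measure_pmf.expectation (K a) (\<lambda>u. D u s'))"
    using c Suc.prems K by (simp, subst expectation_bind_finite) auto
  have 2: "\<bar>measure_pmf.expectation ?p (\<lambda>a. measure_pmf.expectation (K a) (\<lambda>u. D u s'))
     - measure_pmf.expectation ?p (\<lambda>a. measure_pmf.expectation (K' s') (D a))\<bar> \<le> e"
    using c Suc.prems step by (intro expectation_diff_le) auto
  have 3: "measure_pmf.expectation ?p (\<lambda>a. measure_pmf.expectation (K' s') (D a))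
     = measure_pmf.expectation (K' s') (\<lambda>b. measure_pmf.expectation ?p (\<lambda>a. D a b))"
    using c Suc.prems K' by (intro expectation_swap_finite) auto
  have 4: "\<bar>measure_pmf.expectation (K' s') (\<lambda>b. measure_pmf.expectation ?p (\<lambda>a. D a b))
     - measure_pmf.expectation (K' s') (\<lambda>b. measure_pmf.expectation (chain_law K' t b) (D s))\<bar> \<le> real t * e"
    using Suc K' by (intro expectation_diff_le) auto
  have 5: "measure_pmf.expectation (chain_law K' (Suc t) s') (D s)
     = measure_pmf.expectation (K' s') (\<lambda>b. measure_pmf.expectation (chain_law K' t b) (D s))"
    unfolding chain_law_Suc_left using c' Suc.prems K' by (subst expectation_bind_finite) auto
  show ?case using 2 4 unfolding 1 5 3 by (simp add: distrib_right)
qed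

section \<open>Short-time estimates for jump processes\<close>

lemma at_right_0_expansion:
  fixes f :: "real \<Rightarrow> real"
  assumes "(f has_real_derivative d) (at_right 0)" "0 < e"
  shows "\<forall>\<^sub>F h in at_right 0. \<bar>f h - f 0 - d * h\<bar> \<le> e * h"
proof -
  have "((\<lambda>h. (f h - f 0) / (h - 0)) \<longlongrightarrow> d) (at_right 0)"
    using assms(1) by (simp add: has_field_derivative_iff)
  then have "\<forall>\<^sub>F h in at_right 0. dist ((f h - f 0) / (h - 0)) d < e"
    using assms(2) by (rule tendstoD)
  then show ?thesis
    using eventually_at_right_less[of 0]
  proof eventually_elim
    case (elim h)
    have "f h - f 0 - d * h = ((f h - f 0) / h - d) * h"
      using elim(2) by (simp add: field_simps)
    then have "\<bar>f h - f 0 - d * h\<bar> = \<bar>(f h - f 0) / h - d\<bar> * h"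
      using elim(2) by (simp add: abs_mult)
    also have "\<dots> \<le> e * h"
      using elim by (intro mult_right_mono) (auto simp: dist_real_def)
    finally show ?case .
  qed
qed

lemma filterlim_divide_nat_at_right_0:
  fixes t :: real
  assumes "0 < t"
  shows "filterlim (\<lambda>k. t / real k) (at_right 0) sequentially"
  using assms unfolding filterlim_at
  by (auto intro!: tendsto_divide_0[OF tendsto_const] filterlim_at_top_imp_at_infinity
      filterlim_real_sequentially eventually_sequentiallyI[of 1])

lemma markov_jump_law_iterate:
  assumes P: "markov_jump_law S r P" and s: "s \<in> S" and h: "0 \<le> h"
  shows "P (real k * h) s = chain_law (P h) k s"
proof (induction k)
  case 0
  then show ?case using P s by (simp add: markov_jump_law_def)
next
  case (Suc k)
  have "P (real k * h + h) s = bind_pmf (P (real k * h) s) (P h)"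
    using P s h by (simp add: markov_jump_law_def)
  then show ?case using Suc.IH by (simp add: distrib_right add.commute)
qed

lemma markov_jump_law_deriv:
  assumes "markov_jump_law S r P" "s \<in> S" "u \<in> S"
  shows "((\<lambda>h. pmf (P h s) u) has_real_derivative generator S r s u) (at_right 0)"
  using assms unfolding markov_jump_law_def by blast

lemma markov_jump_law_0:
  assumes "markov_jump_law S r P" "s \<in> S"
  shows "P 0 s = return_pmf s"
  using assms by (simp add: markov_jump_law_def)

text \<open>The rates from \<open>s\<close> vanish outside \<open>C\<close>, so the infinite sum in
  the diagonal entry is finite and the generator takes its difference form.\<close>

lemma generator_row:
  assumes C: "finite C" "C \<subseteq> S" "s \<in> C" and r: "\<And>u. u \<in> S - C \<Longrightarrow> r s u = 0"
  shows "(\<Sum>u\<in>C. generator S r s u * f u) = (\<Sum>u\<in>C - {s}. r s u * (f u - f s))"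
proof -
  have "(\<Sum>\<^sub>\<infinity>u\<in>S - {s}. r s u) = (\<Sum>\<^sub>\<infinity>u\<in>C - {s}. r s u)"
    using C r by (intro infsum_cong_neutral) auto
  then have "generator S r s s = - (\<Sum>u\<in>C - {s}. r s u)"
    using C by (simp add: generator_def)
  then have "(\<Sum>u\<in>C. generator S r s u * f u)
     = - (\<Sum>u\<in>C - {s}. r s u) * f s + (\<Sum>u\<in>C - {s}. r s u * f u)"
    using C by (subst sum.remove[of _ s]) (auto simp: generator_def)
  then show ?thesis
    by (simp add: right_diff_distrib sum_subtractf sum_distrib_right)
qed

text \<open>By the semigroup property the probability of staying in a closed class is
  supermultiplicative, and it is \<open>1 - o(h)\<close> for short times \<open>h\<close>.\<close>

lemma markov_jump_law_closed:
  assumes P: "markov_jump_law S r P" and C: "finite C" "C \<subseteq> S"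
    and r: "\<And>s u. s \<in> C \<Longrightarrow> u \<in> S - C \<Longrightarrow> r s u = 0"
    and s: "s \<in> C" and t: "0 \<le> t"
  shows "set_pmf (P t s) \<subseteq> C"
proof -
  define p where "p = (\<lambda>t s. \<Sum>u\<in>C. pmf (P t s) u)"
  have p_prob: "p t s = measure_pmf.prob (P t s) C" for t s
    using C by (simp add: p_def measure_measure_pmf_finite)
  \<comment> \<open>Chapman-Kolmogorov, keeping only intermediate states in
    \<open>C\<close>.\<close>
  have super: "p (a + h) s \<ge> p a s * b" if "0 \<le> a" "0 \<le> h" "s \<in> C" "\<And>u. u \<in> C \<Longrightarrow> b \<le> p h u" for a h s b
  proof -
    have "(\<Sum>x\<in>C. pmf (P a s) x * pmf (P h x) v) \<le> pmf (P (a + h) s) v" for v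
    proof -
      have "(\<Sum>x\<in>C. pmf (P a s) x * pmf (P h x) v)
         = measure_pmf.expectation (P a s) (\<lambda>x. if x \<in> C then pmf (P h x) v else 0)"
        using C by (subst integral_measure_pmf_real[of C]) (auto simp: mult.commute split: if_splits)
      also have "\<dots> \<le> measure_pmf.expectation (P a s) (\<lambda>x. pmf (P h x) v)"
        by (intro integral_mono measure_pmf.integrable_const_bound[where B = 1])
          (auto simp: pmf_le_1)
      also have "\<dots> = pmf (P (a + h) s) v"
        using P that C by (auto simp: markov_jump_law_def pmf_bind)
      finally show ?thesis .
    qed
    then have "(\<Sum>v\<in>C. \<Sum>x\<in>C. pmf (P a s) x * pmf (P h x) v) \<le> p (a + h) s"
      unfolding p_def by (rule sum_mono)
    moreover have "p a s * b \<le> (\<Sum>v\<in>C. \<Sum>x\<in>C. pmf (P a s) x * pmf (P h x) v)"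
    proof -
      have "p a s * b = (\<Sum>x\<in>C. pmf (P a s) x * b)" by (simp add: p_def sum_distrib_right)
      also have "\<dots> \<le> (\<Sum>x\<in>C. pmf (P a s) x * p h x)"
        using that by (intro sum_mono mult_left_mono) auto
      also have "\<dots> = (\<Sum>v\<in>C. \<Sum>x\<in>C. pmf (P a s) x * pmf (P h x) v)"
        unfolding p_def sum_distrib_left by (rule sum.swap)
      finally show ?thesis .
    qed
    ultimately show ?thesis by linarith
  qed
  have p0: "p 0 u = 1" if "u \<in> C" for u
    using markov_jump_law_0[OF P subsetD[OF C(2) that]] that by (simp add: p_prob)
  \<comment> \<open>For \<open>k\<close> large each step of length \<open>h = t / k\<close> loses at
    most the fraction \<open>e * h\<close>, and Bernoulli's inequality bounds the loss over
    \<open>k\<close> steps by \<open>e * t\<close>. The condition \<open>h < 1 / e\<close> keeps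
    \<open>1 - e * h\<close> nonnegative.\<close>
  have lower: "p t s \<ge> 1 - e * t" if e: "0 < e" for e
  proof (cases "t = 0")
    case True
    then show ?thesis using p0 s by simp
  next
    case False
    then have tpos: "0 < t" using t by simp
    have ev: "\<forall>\<^sub>F h in at_right 0. \<forall>u\<in>C. 1 - e * h \<le> p h u"
    proof (rule eventually_ball_finite[OF C(1)], rule ballI)
      fix u assume u: "u \<in> C"
      have "((\<lambda>h. p h u) has_real_derivative (\<Sum>v\<in>C. generator S r u v)) (at_right 0)"
        unfolding p_def using C u by (intro DERIV_sum markov_jump_law_deriv[OF P]) auto
      moreover have "(\<Sum>v\<in>C. generator S r u v) = 0"
        using generator_row[OF C u, of r "\<lambda>_. 1"] r[OF u] by simp
      ultimately have "\<forall>\<^sub>F h in at_right 0. \<bar>p h u - p 0 u - 0 * h\<bar> \<le> e * h"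
        using at_right_0_expansion[of "\<lambda>h. p h u" 0 e] e by simp
      then show "\<forall>\<^sub>F h in at_right 0. 1 - e * h \<le> p h u"
        by eventually_elim (use p0[OF u] in auto)
    qed
    moreover have "\<forall>\<^sub>F h in at_right 0. h < 1 / e"
      using e by (intro eventually_mono[OF eventually_at_right_real[of 0 "1 / e"]]) auto
    ultimately have "\<forall>\<^sub>F k in sequentially. (\<forall>u\<in>C. 1 - e * (t / real k) \<le> p (t / real k) u) \<and> t / real k < 1 / e"
      by (intro eventually_compose_filterlim[OF _ filterlim_divide_nat_at_right_0[OF tpos]] eventually_conj)
    then have "\<forall>\<^sub>F k in sequentially. ((\<forall>u\<in>C. 1 - e * (t / real k) \<le> p (t / real k) u) \<and> t / real k < 1 / e) \<and> 0 < k"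
      by (rule eventually_conj[OF _ eventually_gt_at_top])
    from eventually_happens'[OF sequentially_bot this]
    obtain k where k: "k > 0" and ku: "\<And>u. u \<in> C \<Longrightarrow> 1 - e * (t / real k) \<le> p (t / real k) u"
      and ke: "t / real k < 1 / e"
      by blast
    define h where "h = t / real k"
    have h: "0 \<le> h" using t by (simp add: h_def)
    have eh: "0 \<le> 1 - e * h" using ke e by (simp add: h_def field_simps)
    have "p (real j * h) s \<ge> (1 - e * h) ^ j" for j
    proof (induction j)
      case 0
      then show ?case using p0 s by simp
    next
      case (Suc j)
      have "(1 - e * h) ^ Suc j \<le> p (real j * h) s * (1 - e * h)"
        using mult_right_mono[OF Suc.IH eh] by (simp add: mult.commute)
      also have "\<dots> \<le> p (real j * h + h) s"
        using h s ku by (intro super mult_nonneg_nonneg) (auto simp: h_def)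
      finally show ?case by (simp add: distrib_right add.commute)
    qed
    from this[of k] have "(1 - e * h) ^ k \<le> p t s" using k by (simp add: h_def)
    moreover have "1 + real k * (- (e * h)) \<le> (1 + (- (e * h))) ^ k"
      using eh by (intro Bernoulli_inequality) auto
    ultimately show ?thesis using k by (simp add: h_def)
  qed
  have "1 \<le> p t s"
  proof (rule field_le_epsilon)
    fix d :: real assume d: "0 < d"
    \<comment> \<open>Dividing by \<open>t + 1\<close> rather than \<open>t\<close> also covers
      \<open>t = 0\<close>.\<close>
    have "1 - d / (t + 1) * t \<le> p t s" using d t by (intro lower) auto
    moreover have "d / (t + 1) * t \<le> d" using d t by (simp add: field_simps)
    ultimately show "1 \<le> p t s + d" by linarith
  qed
  then have "measure_pmf.prob (P t s) C = 1"
    unfolding p_prob using measure_pmf.prob_le_1[of "P t s" C] by linarith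
  then have "AE x in P t s. x \<in> C" by (simp add: measure_pmf.prob_eq_1)
  then show ?thesis by (auto simp: AE_measure_pmf_iff)
qed

text \<open>Splitting \<open>[0, t]\<close> into \<open>k\<close> equal steps, duality of the generators gives duality of each
  step up to \<open>o(1/k)\<close>.\<close>

lemma markov_jump_law_duality:
  fixes D :: "'a \<Rightarrow> 'b \<Rightarrow> real"
  assumes P: "markov_jump_law S r P" and P': "markov_jump_law S' r' P'"
    and C: "finite C" "C \<subseteq> S" "\<And>s u. s \<in> C \<Longrightarrow> u \<in> S - C \<Longrightarrow> r s u = 0"
    and C': "finite C'" "C' \<subseteq> S'" "\<And>s u. s \<in> C' \<Longrightarrow> u \<in> S' - C' \<Longrightarrow> r' s u = 0"
    and gen: "\<And>s s'. s \<in> C \<Longrightarrow> s' \<in> C' \<Longrightarrow>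
      (\<Sum>u\<in>C - {s}. r s u * (D u s' - D s s')) = (\<Sum>u\<in>C' - {s'}. r' s' u * (D s u - D s s'))"
    and s: "s \<in> C" and s': "s' \<in> C'" and t: "0 \<le> t"
  shows "measure_pmf.expectation (P t s) (\<lambda>u. D u s') = measure_pmf.expectation (P' t s') (D s)"
proof (cases "t = 0")
  case True
  have "P 0 s = return_pmf s" "P' 0 s' = return_pmf s'"
    using markov_jump_law_0[OF P subsetD[OF C(2) s]] markov_jump_law_0[OF P' subsetD[OF C'(2) s']] by auto
  then show ?thesis using True by simp
next
  case False
  then have tpos: "0 < t" using t by simp
  have closed: "set_pmf (P h a) \<subseteq> C" if "a \<in> C" "0 \<le> h" for a h
    using that C(3) by (intro markov_jump_law_closed[OF P C(1,2)])
  have closed': "set_pmf (P' h a) \<subseteq> C'" if "a \<in> C'" "0 \<le> h" for a h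
    using that C'(3) by (intro markov_jump_law_closed[OF P' C'(1,2)])
  let ?E = "\<lambda>h s s'. (\<Sum>u\<in>C. pmf (P h s) u * D u s') - (\<Sum>u\<in>C'. pmf (P' h s') u * D s u)"
  have E: "measure_pmf.expectation (P h s) (\<lambda>u. D u s') - measure_pmf.expectation (P' h s') (D s) = ?E h s s'"
    if "s \<in> C" "s' \<in> C'" "0 \<le> h" for h s s'
    using that closed closed' C C' by (simp add: expectation_finite)
  \<comment> \<open>At \<open>h = 0\<close> the difference \<open>?E\<close> vanishes, and so does
    its right derivative, by \<open>gen\<close>. Finiteness of \<open>C\<close> and
    \<open>C'\<close> makes the resulting bound uniform in the states.\<close>
  have small: "\<forall>\<^sub>F h in at_right 0. \<forall>s\<in>C. \<forall>s'\<in>C'. \<bar>?E h s s'\<bar> \<le> e * h" if e: "0 < e" for e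
  proof (intro eventually_ball_finite C C' ballI)
    fix s s' assume s: "s \<in> C" and s': "s' \<in> C'"
    have d1: "((\<lambda>h. pmf (P h s) u) has_real_derivative generator S r s u) (at_right 0)" if "u \<in> C" for u
      using s that C by (intro markov_jump_law_deriv[OF P]) auto
    have d2: "((\<lambda>h. pmf (P' h s') u) has_real_derivative generator S' r' s' u) (at_right 0)" if "u \<in> C'" for u
      using s' that C' by (intro markov_jump_law_deriv[OF P']) auto
    have "((\<lambda>h. ?E h s s') has_real_derivative
       (\<Sum>u\<in>C. generator S r s u * D u s') - (\<Sum>u\<in>C'. generator S' r' s' u * D s u)) (at_right 0)"
      by (intro DERIV_diff DERIV_sum DERIV_cmult_right d1 d2)
    moreover have "(\<Sum>u\<in>C. generator S r s u * D u s') - (\<Sum>u\<in>C'. generator S' r' s' u * D s u) = 0"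
      using generator_row[OF C(1,2) s, of r "\<lambda>u. D u s'", OF C(3)[OF s]]
        generator_row[OF C'(1,2) s', of r' "D s", OF C'(3)[OF s']] gen[OF s s'] by simp
    ultimately have "\<forall>\<^sub>F h in at_right 0. \<bar>?E h s s' - ?E 0 s s' - 0 * h\<bar> \<le> e * h"
      using at_right_0_expansion[of "\<lambda>h. ?E h s s'" 0 e] e by simp
    moreover have "?E 0 s s' = 0"
      using E[OF s s', of 0] markov_jump_law_0[OF P subsetD[OF C(2) s]]
        markov_jump_law_0[OF P' subsetD[OF C'(2) s']] by simp
    ultimately show "\<forall>\<^sub>F h in at_right 0. \<bar>?E h s s'\<bar> \<le> e * h" by simp
  qed
  have bound: "\<bar>measure_pmf.expectation (P t s) (\<lambda>u. D u s') - measure_pmf.expectation (P' t s') (D s)\<bar> \<le> e * t"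
    if e: "0 < e" for e
  proof -
    have "\<forall>\<^sub>F k in sequentially. 0 < k \<and> (\<forall>s\<in>C. \<forall>s'\<in>C'. \<bar>?E (t / real k) s s'\<bar> \<le> e * (t / real k))"
      by (intro eventually_conj eventually_gt_at_top
          eventually_compose_filterlim[OF small[OF e] filterlim_divide_nat_at_right_0[OF tpos]])
    from eventually_happens'[OF sequentially_bot this]
    obtain k where k: "0 < k"
      and ks: "\<And>s s'. s \<in> C \<Longrightarrow> s' \<in> C' \<Longrightarrow> \<bar>?E (t / real k) s s'\<bar> \<le> e * (t / real k)"
      by blast
    define h where "h = t / real k"
    have h: "0 \<le> h" "t = real k * h" using t k by (auto simp: h_def)
    have "P t s = chain_law (P h) k s" "P' t s' = chain_law (P' h) k s'"
      using markov_jump_law_iterate[OF P subsetD[OF C(2) s] h(1), of k]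
        markov_jump_law_iterate[OF P' subsetD[OF C'(2) s'] h(1), of k] h(2) by simp_all
    moreover have "\<bar>measure_pmf.expectation (chain_law (P h) k s) (\<lambda>u. D u s')
       - measure_pmf.expectation (chain_law (P' h) k s') (D s)\<bar> \<le> real k * (e * h)"
    proof (rule chain_law_duality_approx[of C _ C'])
      show "set_pmf (P h a) \<subseteq> C \<and> finite (set_pmf (P h a))" if a: "a \<in> C" for a
        using closed[OF a h(1)] finite_subset[OF closed[OF a h(1)] C(1)] by simp
      show "set_pmf (P' h b) \<subseteq> C' \<and> finite (set_pmf (P' h b))" if b: "b \<in> C'" for b
        using closed'[OF b h(1)] finite_subset[OF closed'[OF b h(1)] C'(1)] by simp
      show "\<bar>measure_pmf.expectation (P h a) (\<lambda>u. D u b) - measure_pmf.expectation (P' h b) (D a)\<bar> \<le> e * h"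
        if a: "a \<in> C" and b: "b \<in> C'" for a b
        unfolding E[OF a b h(1)] using ks[OF a b] by (simp add: h_def)
      show "s \<in> C" "s' \<in> C'" by (fact s s')+
    qed
    moreover have "real k * (e * h) = e * t" using h(2) by simp
    ultimately show ?thesis by simp
  qed
  have "\<bar>measure_pmf.expectation (P t s) (\<lambda>u. D u s') - measure_pmf.expectation (P' t s') (D s)\<bar> \<le> 0"
  proof (rule field_le_epsilon)
    fix d :: real assume "0 < d"
    then show "\<bar>measure_pmf.expectation (P t s) (\<lambda>u. D u s') - measure_pmf.expectation (P' t s') (D s)\<bar> \<le> 0 + d"
      using bound[of "d / t"] tpos by simp
  qed
  then show ?thesis by simp
qed

section \<open>Duality of the two zero range processes\<close>

lemma Phi_nonneg:
  assumes Q: "0 < Q" "Q < 1" and lm: "0 < l" "0 \<le> m" "m \<le> l" "l \<le> 1" "m < 1"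
  shows "0 \<le> Phi n Q g b l m"
proof -
  have p: "0 \<le> qpoch a Q k" if "a \<le> 1" for a k
    using that Q by (intro qpoch_nonneg) auto
  show ?thesis
    unfolding Phi_def using Q lm
    by (intro mult_nonneg_nonneg divide_nonneg_nonneg prod_nonneg p zero_le_power ballI) auto
qed

lemma pmf_Phi_pmf:
  assumes Q: "0 < Q" "Q < 1" and lm: "0 < l" "0 \<le> m" "m \<le> l" "l \<le> 1" "m < 1" and b: "b \<in> vecs n"
  shows "pmf (Phi_pmf n Q l m b) g = (if g \<le> b then Phi n Q g b l m else 0)"
proof -
  let ?f = "\<lambda>g. if g \<le> b then Phi n Q g b l m else 0"
  have nn: "0 \<le> ?f g" for g using Phi_nonneg[OF Q lm] by simp
  have "(\<integral>\<^sup>+g. ennreal (?f g) \<partial>count_space UNIV) = (\<Sum>g\<in>{..b}. ennreal (?f g))"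
    using finite_box[OF b] by (intro nn_integral_count_space') auto
  also have "\<dots> = ennreal (\<Sum>g\<in>{..b}. ?f g)" by (rule sum_ennreal) (rule nn)
  also have "(\<Sum>g\<in>{..b}. ?f g) = 1" using sum_Phi[OF Q lm(2,5) _ b, of l] lm(1) by simp
  finally show ?thesis
    unfolding Phi_pmf_def using nn by (subst pmf_embed_pmf) auto
qed

lemma set_Phi_pmf:
  assumes "0 < Q" "Q < 1" "0 < l" "0 \<le> m" "m \<le> l" "l \<le> 1" "m < 1" "b \<in> vecs n"
  shows "set_pmf (Phi_pmf n Q l m b) \<subseteq> {..b}"
  by (auto simp: set_pmf_eq pmf_Phi_pmf[OF assms])

lemma expectation_Phi_pmf:
  assumes "0 < Q" "Q < 1" "0 < l" "0 \<le> m" "m \<le> l" "l \<le> 1" "m < 1" "b \<in> vecs n"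
  shows "measure_pmf.expectation (Phi_pmf n Q l m b) f = Phi_op n Q l m f b"
  unfolding expectation_finite[OF finite_box[OF assms(8)] set_Phi_pmf[OF assms]] Phi_op_def
  by (intro sum.cong) (auto simp: pmf_Phi_pmf[OF assms])

lemma configs_vecs: "\<xi> \<in> configs n L \<Longrightarrow> \<xi> x \<in> vecs n"
  by (force simp: configs_def vecs_def)

lemma set_Pi_Phi_pmf:
  assumes "0 < Q" "Q < 1" "0 < l" "0 \<le> m" "m \<le> l" "l \<le> 1" "m < 1"
    and \<xi>: "\<xi> \<in> configs n L" and A: "finite A"
  shows "set_pmf (Pi_pmf A (\<lambda>_. 0) (\<lambda>x. Phi_pmf n Q l m (\<xi> x))) \<subseteq> {c. c \<le> \<xi> \<and> (\<forall>x. x \<notin> A \<longrightarrow> c x = (\<lambda>_. 0))}"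
    and "finite (set_pmf (Pi_pmf A (\<lambda>_. 0) (\<lambda>x. Phi_pmf n Q l m (\<xi> x))))"
proof -
  note s = set_Phi_pmf[OF assms(1-7) configs_vecs[OF \<xi>]]
  show "set_pmf (Pi_pmf A (\<lambda>_. 0) (\<lambda>x. Phi_pmf n Q l m (\<xi> x))) \<subseteq> {c. c \<le> \<xi> \<and> (\<forall>x. x \<notin> A \<longrightarrow> c x = (\<lambda>_. 0))}"
  proof
    fix c assume "c \<in> set_pmf (Pi_pmf A (\<lambda>_. 0) (\<lambda>x. Phi_pmf n Q l m (\<xi> x)))"
    then have c: "\<And>x. x \<in> A \<Longrightarrow> c x \<le> \<xi> x" "\<And>x. x \<notin> A \<Longrightarrow> c x = (\<lambda>_. 0)"
      using s by (fastforce simp: set_Pi_pmf[OF A] PiE_dflt_def)+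
    have "c x \<le> \<xi> x" for x using c[of x] by (cases "x \<in> A") (auto simp: le_fun_def)
    then show "c \<in> {c. c \<le> \<xi> \<and> (\<forall>x. x \<notin> A \<longrightarrow> c x = (\<lambda>_. 0))}" using c(2) by (simp add: le_fun_def)
  qed
  have "finite (set_pmf (Phi_pmf n Q l m (\<xi> x)))" for x
    using s finite_box[OF configs_vecs[OF \<xi>]] by (rule finite_subset)
  then show "finite (set_pmf (Pi_pmf A (\<lambda>_. 0) (\<lambda>x. Phi_pmf n Q l m (\<xi> x))))"
    using A by (auto simp: set_Pi_pmf)
qed

lemma move_right_configs:
  assumes "\<xi> \<in> configs n L" "c \<le> \<xi>" "\<And>x. x \<notin> {1..<L} \<Longrightarrow> c x = (\<lambda>_. 0)"
  shows "move_right \<xi> c \<in> configs n L"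
  unfolding configs_def
proof (intro CollectI allI impI)
  fix x i assume "move_right \<xi> c x i \<noteq> 0"
  then consider "\<xi> x i \<noteq> 0" | "c (x - 1) i \<noteq> 0" by (auto simp: move_right_def)
  then show "x \<in> {1..L} \<and> i < n"
  proof cases
    case 1
    then show ?thesis using assms(1) by (auto simp: configs_def)
  next
    case 2
    then have "x - 1 \<in> {1..<L}" using assms(3)[of "x - 1"] by (cases "x - 1 \<in> {1..<L}") auto
    then have "x \<in> {1..L}" by (simp, linarith)
    moreover have "\<xi> (x - 1) i \<noteq> 0" using 2 le_funD[OF le_funD[OF assms(2)], of "x - 1" i] by simp
    ultimately show ?thesis using assms(1) by (auto simp: configs_def)
  qed
qed

lemma move_left_configs:
  assumes "\<eta> \<in> configs n L" "c \<le> \<eta>" "\<And>x. x \<notin> {2..L} \<Longrightarrow> c x = (\<lambda>_. 0)"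
  shows "move_left \<eta> c \<in> configs n L"
  unfolding configs_def
proof (intro CollectI allI impI)
  fix x i assume "move_left \<eta> c x i \<noteq> 0"
  then consider "\<eta> x i \<noteq> 0" | "c (x + 1) i \<noteq> 0" by (auto simp: move_left_def)
  then show "x \<in> {1..L} \<and> i < n"
  proof cases
    case 1
    then show ?thesis using assms(1) by (auto simp: configs_def)
  next
    case 2
    then have "x + 1 \<in> {2..L}" using assms(3)[of "x + 1"] by (cases "x + 1 \<in> {2..L}") auto
    then have "x \<in> {1..L}" by simp
    moreover have "\<eta> (x + 1) i \<noteq> 0" using 2 le_funD[OF le_funD[OF assms(2)], of "x + 1" i] by simp
    ultimately show ?thesis using assms(1) by (auto simp: configs_def)
  qed
qed

text \<open>By independence the expectation factorises over bonds, and \<open>Phi_op_bond\<close>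
  exchanges the variable on each one. The site \<open>x\<close> of the first configuration faces the
  site \<open>x + 1\<close> of the second, hence the shift between \<open>{1..<L}\<close> and
  \<open>{2..L}\<close>.\<close>

lemma step_duality:
  assumes q: "0 < q" "q < 1" and L: "1 \<le> L" and lm: "0 < l" "0 \<le> m" "m \<le> l" "l \<le> 1" "m < 1"
    and \<xi>: "\<xi> \<in> configs n L" and \<eta>: "\<eta> \<in> configs n L"
  shows "measure_pmf.expectation (step_right n L (q\<^sup>2) l m \<xi>) (\<lambda>\<xi>'. Dual n L q \<xi>' \<eta>)
       = measure_pmf.expectation (step_left n L (q\<^sup>2) l m \<eta>) (Dual n L q \<xi>)"
proof -
  define Q where "Q = q\<^sup>2"
  have Q: "0 < Q" "Q < 1" using q by (simp_all add: Q_def power_less_one_iff)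
  note set = set_Pi_Phi_pmf[OF Q lm]
  note E = expectation_Phi_pmf[OF Q lm]
  have fin: "finite (set_pmf (Phi_pmf n Q l m b))" if "b \<in> vecs n" for b
    using set_Phi_pmf[OF Q lm that] finite_box[OF that] by (rule finite_subset)
  let ?z = "site_z n L q \<xi> \<eta>"
  have "measure_pmf.expectation (step_right n L Q l m \<xi>) (\<lambda>\<xi>'. Dual n L q \<xi>' \<eta>)
    = measure_pmf.expectation (Pi_pmf {1..<L} (\<lambda>_. 0) (\<lambda>x. Phi_pmf n Q l m (\<xi> x)))
       (\<lambda>c. Dual n L q (move_right \<xi> c) \<eta>)"
    by (simp add: step_right_def)
  also have "\<dots> = measure_pmf.expectation (Pi_pmf {1..<L} (\<lambda>_. 0) (\<lambda>x. Phi_pmf n Q l m (\<xi> x)))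
       (\<lambda>c. Dual n L q \<xi> \<eta> * (\<Prod>x\<in>{1..<L}. bond n Q (?z x) (c x) (\<eta> (x + 1))))"
  proof (rule integral_cong_AE)
    show "AE c in Pi_pmf {1..<L} (\<lambda>_. 0) (\<lambda>x. Phi_pmf n Q l m (\<xi> x)).
       Dual n L q (move_right \<xi> c) \<eta> = Dual n L q \<xi> \<eta> * (\<Prod>x\<in>{1..<L}. bond n Q (?z x) (c x) (\<eta> (x + 1)))"
      unfolding AE_measure_pmf_iff
    proof
      fix c assume "c \<in> set_pmf (Pi_pmf {1..<L} (\<lambda>_. 0) (\<lambda>x. Phi_pmf n Q l m (\<xi> x)))"
      then have "c \<le> \<xi> \<and> (\<forall>x. x \<notin> {1..<L} \<longrightarrow> c x = (\<lambda>_. 0))"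
        using set(1)[OF \<xi>, of "{1..<L}"] by blast
      then show "Dual n L q (move_right \<xi> c) \<eta>
          = Dual n L q \<xi> \<eta> * (\<Prod>x\<in>{1..<L}. bond n Q (?z x) (c x) (\<eta> (x + 1)))"
        unfolding Q_def by (intro Dual_move_right[OF q L]) auto
    qed
  qed auto
  also have "\<dots> = Dual n L q \<xi> \<eta> * (\<Prod>x\<in>{1..<L}. Phi_op n Q l m (\<lambda>g. bond n Q (?z x) g (\<eta> (x + 1))) (\<xi> x))"
    using fin[OF configs_vecs[OF \<xi>]]
    by (simp add: expectation_prod_Pi_pmf_finite[where f = "\<lambda>x g. bond n Q (?z x) g (\<eta> (x + 1))", simplified]
        E[OF configs_vecs[OF \<xi>]])
  also have "(\<Prod>x\<in>{1..<L}. Phi_op n Q l m (\<lambda>g. bond n Q (?z x) g (\<eta> (x + 1))) (\<xi> x))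
     = (\<Prod>x\<in>{1..<L}. Phi_op n Q l m (bond n Q (?z x) (\<xi> x)) (\<eta> (x + 1)))"
    using lm bond_z_neq[OF q]
    by (intro prod.cong refl Phi_op_bond[OF Q] configs_vecs[OF \<xi>] configs_vecs[OF \<eta>])
      (auto simp: site_z_def Q_def)
  also have shift: "(\<Prod>x\<in>{1..<L}. F (x + 1)) = (\<Prod>x\<in>{2..L}. F x)" for F :: "nat \<Rightarrow> real"
    by (rule prod.reindex_bij_witness[of _ "\<lambda>x. x - 1" "\<lambda>x. x + 1"]) auto
  have "(\<Prod>x\<in>{1..<L}. Phi_op n Q l m (bond n Q (?z x) (\<xi> x)) (\<eta> (x + 1)))
     = (\<Prod>x\<in>{2..L}. Phi_op n Q l m (bond n Q (?z (x - 1)) (\<xi> (x - 1))) (\<eta> x))"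
    using shift[of "\<lambda>x. Phi_op n Q l m (bond n Q (?z (x - 1)) (\<xi> (x - 1))) (\<eta> x)"] by simp
  also have "Dual n L q \<xi> \<eta> * (\<Prod>x\<in>{2..L}. Phi_op n Q l m (bond n Q (?z (x - 1)) (\<xi> (x - 1))) (\<eta> x))
     = measure_pmf.expectation (Pi_pmf {2..L} (\<lambda>_. 0) (\<lambda>x. Phi_pmf n Q l m (\<eta> x)))
       (\<lambda>c. Dual n L q \<xi> \<eta> * (\<Prod>x\<in>{2..L}. bond n Q (?z (x - 1)) (\<xi> (x - 1)) (c x)))"
    using fin[OF configs_vecs[OF \<eta>]]
    by (simp add: expectation_prod_Pi_pmf_finite[where f = "\<lambda>x. bond n Q (?z (x - 1)) (\<xi> (x - 1))", simplified]
        E[OF configs_vecs[OF \<eta>]])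
  also have "\<dots> = measure_pmf.expectation (Pi_pmf {2..L} (\<lambda>_. 0) (\<lambda>x. Phi_pmf n Q l m (\<eta> x)))
       (\<lambda>c. Dual n L q \<xi> (move_left \<eta> c))"
  proof (rule integral_cong_AE)
    show "AE c in Pi_pmf {2..L} (\<lambda>_. 0) (\<lambda>x. Phi_pmf n Q l m (\<eta> x)).
       Dual n L q \<xi> \<eta> * (\<Prod>x\<in>{2..L}. bond n Q (?z (x - 1)) (\<xi> (x - 1)) (c x)) = Dual n L q \<xi> (move_left \<eta> c)"
      unfolding AE_measure_pmf_iff
    proof
      fix c assume "c \<in> set_pmf (Pi_pmf {2..L} (\<lambda>_. 0) (\<lambda>x. Phi_pmf n Q l m (\<eta> x)))"
      then have "c \<le> \<eta> \<and> (\<forall>x. x \<notin> {2..L} \<longrightarrow> c x = (\<lambda>_. 0))"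
        using set(1)[OF \<eta>, of "{2..L}"] by blast
      then have "Dual n L q \<xi> (move_left \<eta> c)
          = Dual n L q \<xi> \<eta> * (\<Prod>x\<in>{1..<L}. bond n Q (?z x) (\<xi> x) (c (x + 1)))"
        unfolding Q_def by (intro Dual_move_left[OF q L]) auto
      then show "Dual n L q \<xi> \<eta> * (\<Prod>x\<in>{2..L}. bond n Q (?z (x - 1)) (\<xi> (x - 1)) (c x)) = Dual n L q \<xi> (move_left \<eta> c)"
        using shift[of "\<lambda>x. bond n Q (?z (x - 1)) (\<xi> (x - 1)) (c x)"] by simp
    qed
  qed auto
  also have "\<dots> = measure_pmf.expectation (step_left n L Q l m \<eta>) (Dual n L q \<xi>)"
    by (simp add: step_left_def)
  finally show ?thesis by (simp add: Q_def)
qed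

lemma step_configs:
  assumes Q: "0 < Q" "Q < 1" and lm: "0 < l" "0 \<le> m" "m \<le> l" "l \<le> 1" "m < 1" and \<xi>: "\<xi> \<in> configs n L"
  shows "set_pmf (step_right n L Q l m \<xi>) \<subseteq> configs n L \<and> finite (set_pmf (step_right n L Q l m \<xi>))"
    and "set_pmf (step_left n L Q l m \<xi>) \<subseteq> configs n L \<and> finite (set_pmf (step_left n L Q l m \<xi>))"
proof -
  note s = set_Pi_Phi_pmf[OF Q lm \<xi>]
  show "set_pmf (step_right n L Q l m \<xi>) \<subseteq> configs n L \<and> finite (set_pmf (step_right n L Q l m \<xi>))"
    unfolding step_right_def using s(1)[of "{1..<L}"] s(2)[of "{1..<L}"]
    by (auto intro!: move_right_configs[OF \<xi>] dest!: subsetD)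
  show "set_pmf (step_left n L Q l m \<xi>) \<subseteq> configs n L \<and> finite (set_pmf (step_left n L Q l m \<xi>))"
    unfolding step_left_def using s(1)[of "{2..L}"] s(2)[of "{2..L}"]
    by (auto intro!: move_left_configs[OF \<xi>] dest!: subsetD)
qed

lemma discrete_duality:
  assumes q: "0 < q" "q < 1" and L: "1 \<le> L" and lm: "0 < l" "0 \<le> m" "m \<le> l" "l \<le> 1" "m < 1"
    and \<xi>: "\<xi> \<in> configs n L" and \<eta>: "\<eta> \<in> configs n L"
  shows "measure_pmf.expectation (chain_law (step_right n L (q\<^sup>2) l m) t \<xi>) (\<lambda>\<xi>'. Dual n L q \<xi>' \<eta>)
       = measure_pmf.expectation (chain_law (step_left n L (q\<^sup>2) l m) t \<eta>) (Dual n L q \<xi>)"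
proof -
  have Q: "0 < q\<^sup>2" "q\<^sup>2 < 1" using q by (simp_all add: power_less_one_iff)
  have "\<bar>measure_pmf.expectation (chain_law (step_right n L (q\<^sup>2) l m) t \<xi>) (\<lambda>\<xi>'. Dual n L q \<xi>' \<eta>)
       - measure_pmf.expectation (chain_law (step_left n L (q\<^sup>2) l m) t \<eta>) (Dual n L q \<xi>)\<bar> \<le> real t * 0"
    using step_duality[OF q L lm] step_configs[OF Q lm] \<xi> \<eta>
    by (intro chain_law_duality_approx[of "configs n L" _ "configs n L"]) simp_all
  then show ?thesis by simp
qed

section \<open>Jump rates as derivatives of the weights at \<open>l = 1\<close>\<close>

lemma field_differentiable_qpoch:
  "f field_differentiable at x \<Longrightarrow> (\<lambda>l. qpoch (f l) Q k) field_differentiable at x"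
  by (induction k) (auto simp: qpoch_Suc intro!: field_differentiable_mult field_differentiable_diff)

lemma Phi_has_derivative:
  assumes "0 < Q" "Q < 1" "0 \<le> m" "m < 1"
  shows "((\<lambda>l. Phi n Q g b l m) has_real_derivative - jump_rate n Q m g b) (at 1)"
proof -
  have "qpoch m Q (vsum n b) \<noteq> 0" using qpoch_pos[of Q m "vsum n b"] assms by simp
  moreover have "(\<lambda>l. m / l) field_differentiable at 1"
    by (intro field_differentiable_divide field_differentiable_const field_differentiable_ident) simp
  ultimately have "(\<lambda>l. Phi n Q g b l m) field_differentiable at 1"
    unfolding Phi_def
    by (intro field_differentiable_mult field_differentiable_divide[of _ _ _ "\<lambda>_. qpoch m Q (vsum n b)"]
        field_differentiable_power field_differentiable_const field_differentiable_qpoch field_differentiable_ident)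
  then show ?thesis
    unfolding jump_rate_def by (simp add: field_differentiable_derivI)
qed

text \<open>The total mass is constant in \<open>l\<close>. So \<open>jump_rate\<close> at the zero
  vector is minus the total rate of the actual jumps, and a sum over the full box is already in
  generator form.\<close>

lemma sum_jump_rate:
  assumes Q: "0 < Q" "Q < 1" and m: "0 \<le> m" "m < 1" and b: "b \<in> vecs n"
  shows "(\<Sum>g\<in>{..b}. jump_rate n Q m g b) = 0"
proof -
  have "((\<lambda>l. \<Sum>g\<in>{..b}. Phi n Q g b l m) has_real_derivative (\<Sum>g\<in>{..b}. - jump_rate n Q m g b)) (at 1)"
    by (intro DERIV_sum Phi_has_derivative Q m)
  moreover have "((\<lambda>l. \<Sum>g\<in>{..b}. Phi n Q g b l m) has_real_derivative 0) (at 1)"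
    by (rule has_field_derivative_transform_within_open[of "\<lambda>_. 1" 0 1 "{0<..}"])
      (auto simp: sum_Phi[OF Q m _ b])
  ultimately show ?thesis using DERIV_unique by (fastforce simp: sum_negf)
qed

text \<open>\<open>Phi_op_bond\<close> differentiated at \<open>l = 1\<close>; it holds on the whole
  open set \<open>l > 0\<close>, so both sides have the same two-sided derivative.\<close>

lemma sum_jump_rate_bond:
  assumes Q: "0 < Q" "Q < 1" and m: "0 \<le> m" "m < 1" and z: "\<And>j k. z j * Q ^ k \<noteq> 1"
    and b: "b \<in> vecs n" and y: "y \<in> vecs n"
  shows "(\<Sum>g\<in>{..b}. jump_rate n Q m g b * bond n Q z g y) = (\<Sum>g\<in>{..y}. jump_rate n Q m g y * bond n Q z b g)"
proof -
  have 1: "((\<lambda>l. Phi_op n Q l m (\<lambda>g. bond n Q z g y) b) has_real_derivative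
      (\<Sum>g\<in>{..b}. - jump_rate n Q m g b * bond n Q z g y)) (at 1)"
    unfolding Phi_op_def by (intro DERIV_sum DERIV_cmult_right Phi_has_derivative Q m)
  have 2: "((\<lambda>l. Phi_op n Q l m (bond n Q z b) y) has_real_derivative
      (\<Sum>g\<in>{..y}. - jump_rate n Q m g y * bond n Q z b g)) (at 1)"
    unfolding Phi_op_def by (intro DERIV_sum DERIV_cmult_right Phi_has_derivative Q m)
  have "((\<lambda>l. Phi_op n Q l m (bond n Q z b) y) has_real_derivative
      (\<Sum>g\<in>{..b}. - jump_rate n Q m g b * bond n Q z g y)) (at 1)"
    by (rule has_field_derivative_transform_within_open[OF 1, of "{0<..}"])
      (auto intro: Phi_op_bond[OF Q m _ z b y])
  from DERIV_unique[OF this 2] show ?thesis by (simp add: sum_negf)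
qed

lemma bond_0:
  assumes "\<And>j k. z j * Q ^ k \<noteq> 1"
  shows "bond n Q z (\<lambda>_. 0) y = 1" "bond n Q z g (\<lambda>_. 0) = 1"
proof -
  have "qpoch (z j * Q) Q k \<noteq> 0" for j k
    unfolding qpoch_def using assms[of j "Suc _"] by (simp add: mult.assoc)
  then show "bond n Q z (\<lambda>_. 0) y = 1" "bond n Q z g (\<lambda>_. 0) = 1"
    by (simp_all add: bond_def)
qed

text \<open>The zero vector may be included because \<open>bond\<close> is 1 there. Over the full
  box the constant 1 contributes nothing by \<open>sum_jump_rate\<close>, and
  \<open>sum_jump_rate_bond\<close> remains.\<close>

lemma jump_bond_duality:
  assumes Q: "0 < Q" "Q < 1" and m: "0 \<le> m" "m < 1" and z: "\<And>j k. z j * Q ^ k \<noteq> 1"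
    and b: "b \<in> vecs n" and y: "y \<in> vecs n"
  shows "(\<Sum>g\<in>{..b} - {\<lambda>_. 0}. jump_rate n Q m g b * (bond n Q z g y - 1))
     = (\<Sum>g\<in>{..y} - {\<lambda>_. 0}. jump_rate n Q m g y * (bond n Q z b g - 1))"
proof -
  have "(\<Sum>g\<in>{..b} - {\<lambda>_. 0}. jump_rate n Q m g b * (bond n Q z g y - 1))
     = (\<Sum>g\<in>{..b}. jump_rate n Q m g b * (bond n Q z g y - 1))"
    by (rule sum.mono_neutral_left) (auto simp: finite_box[OF b] bond_0[OF z])
  also have "\<dots> = (\<Sum>g\<in>{..y}. jump_rate n Q m g y * (bond n Q z b g - 1))"
    using sum_jump_rate_bond[OF Q m z b y] sum_jump_rate[OF Q m b] sum_jump_rate[OF Q m y]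
    by (simp add: right_diff_distrib sum_subtractf)
  also have "\<dots> = (\<Sum>g\<in>{..y} - {\<lambda>_. 0}. jump_rate n Q m g y * (bond n Q z b g - 1))"
    by (rule sum.mono_neutral_right) (auto simp: finite_box[OF y] bond_0[OF z])
  finally show ?thesis .
qed

section \<open>Finite classes of fixed particle numbers, and duality of the generators\<close>

definition config_class :: "nat \<Rightarrow> nat \<Rightarrow> config \<Rightarrow> config set" where
  "config_class n L \<xi> = {\<zeta> \<in> configs n L. \<forall>i. Nplus L 1 (\<lambda>x. \<zeta> x i) = Nplus L 1 (\<lambda>x. \<xi> x i)}"

lemma config_class_self: "\<xi> \<in> configs n L \<Longrightarrow> \<xi> \<in> config_class n L \<xi>"
  by (simp add: config_class_def)

lemma config_class_eq: "\<zeta> \<in> config_class n L \<xi> \<Longrightarrow> config_class n L \<zeta> = config_class n L \<xi>"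
  by (simp add: config_class_def)

lemma config_class_subset: "config_class n L \<xi> \<subseteq> configs n L"
  by (auto simp: config_class_def)

text \<open>Each occupation number is bounded by the total of its species, which is fixed in the
  class; sites and species are finitely many.\<close>

lemma finite_config_class: "finite (config_class n L \<xi>)"
proof -
  define N where "N = (\<Sum>i<n. Nplus L 1 (\<lambda>x. \<xi> x i))"
  define V where "V = {v :: nat \<Rightarrow> nat. \<forall>i. (i \<in> {..<n} \<longrightarrow> v i \<in> {..N}) \<and> (i \<notin> {..<n} \<longrightarrow> v i = 0)}"
  have V: "finite V" unfolding V_def by (rule finite_set_of_finite_funs) auto
  have "finite {\<zeta>. \<forall>x. (x \<in> {1..L} \<longrightarrow> \<zeta> x \<in> V) \<and> (x \<notin> {1..L} \<longrightarrow> \<zeta> x = (\<lambda>_. 0))}"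
    by (rule finite_set_of_finite_funs) (auto simp: V)
  moreover have "config_class n L \<xi> \<subseteq> {\<zeta>. \<forall>x. (x \<in> {1..L} \<longrightarrow> \<zeta> x \<in> V) \<and> (x \<notin> {1..L} \<longrightarrow> \<zeta> x = (\<lambda>_. 0))}"
  proof (intro subsetI CollectI allI conjI impI)
    fix \<zeta> x assume \<zeta>: "\<zeta> \<in> config_class n L \<xi>"
    {
      assume x: "x \<in> {1..L}"
      have "\<zeta> x i \<le> N" if i: "i < n" for i
      proof -
        have "\<zeta> x i \<le> Nplus L 1 (\<lambda>x. \<zeta> x i)"
          unfolding Nplus_def using x by (intro member_le_sum) auto
        also have "\<dots> = Nplus L 1 (\<lambda>x. \<xi> x i)" using \<zeta> by (simp add: config_class_def)
        also have "\<dots> \<le> N" unfolding N_def using i by (intro member_le_sum) auto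
        finally show ?thesis .
      qed
      moreover have "\<zeta> x i = 0" if "\<not> i < n" for i
        using \<zeta> that by (auto simp: config_class_def configs_def)
      ultimately show "\<zeta> x \<in> V" by (auto simp: V_def)
    next
      assume "x \<notin> {1..L}"
      then show "\<zeta> x = (\<lambda>_. 0)" using \<zeta> by (auto simp: config_class_def configs_def)
    }
  qed
  ultimately show ?thesis by (rule rev_finite_subset)
qed

lemma move_right_class:
  assumes "\<xi> \<in> configs n L" "c \<le> \<xi>" "\<And>x. x \<notin> {1..<L} \<Longrightarrow> c x = (\<lambda>_. 0)"
  shows "move_right \<xi> c \<in> config_class n L \<xi>"
proof -
  have "Nplus L 1 (\<lambda>x. move_right \<xi> c x i) = Nplus L 1 (\<lambda>x. \<xi> x i)" for i
    unfolding move_right_def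
    using Nplus_right[of "\<lambda>x. c x i" "\<lambda>x. \<xi> x i" L 1] assms(2) assms(3)[of 0] assms(3)[of L]
    by (simp add: le_fun_def)
  then show ?thesis using move_right_configs[OF assms] by (simp add: config_class_def)
qed

lemma move_left_class:
  assumes "\<eta> \<in> configs n L" "c \<le> \<eta>" "\<And>x. x \<notin> {2..L} \<Longrightarrow> c x = (\<lambda>_. 0)"
  shows "move_left \<eta> c \<in> config_class n L \<eta>"
proof -
  have "Nplus L 1 (\<lambda>x. move_left \<eta> c x i) = Nplus L 1 (\<lambda>x. \<eta> x i)" for i
    unfolding move_left_def
    using Nplus_left[of "\<lambda>x. c x i" "\<lambda>x. \<eta> x i" L 1] assms(2) assms(3)[of 1] assms(3)[of "Suc L"]
    by (simp add: le_fun_def)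
  then show ?thesis using move_left_configs[OF assms] by (simp add: config_class_def)
qed

definition jumps :: "nat set \<Rightarrow> config \<Rightarrow> (nat \<times> (nat \<Rightarrow> nat)) set" where
  "jumps A \<xi> = (SIGMA x:A. {..\<xi> x} - {\<lambda>_. 0})"

text \<open>Rates are attached to target configurations and collect all jumps with that target.
  Grouping by target turns the generator into a sum over individual jumps, whether or not different
  jumps share a target.\<close>

lemma sum_jumps_group:
  fixes F :: "config \<Rightarrow> real" and mv :: "nat \<times> (nat \<Rightarrow> nat) \<Rightarrow> config"
  assumes A: "finite A" and \<xi>: "\<xi> \<in> configs n L" and C: "finite C" "mv ` jumps A \<xi> \<subseteq> C"
  shows "(\<Sum>u\<in>C. (\<Sum>p\<in>{p \<in> jumps A \<xi>. mv p = u}. w p) * F u)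
     = (\<Sum>x\<in>A. \<Sum>g\<in>{..\<xi> x} - {\<lambda>_. 0}. w (x, g) * F (mv (x, g)))"
proof -
  have fb: "finite ({..\<xi> x} - {\<lambda>_. 0})" for x using finite_box[OF configs_vecs[OF \<xi>]] by simp
  have fin: "finite (jumps A \<xi>)" unfolding jumps_def using A fb by (rule finite_SigmaI)
  have "(\<Sum>u\<in>C. (\<Sum>p\<in>{p \<in> jumps A \<xi>. mv p = u}. w p) * F u)
     = (\<Sum>u\<in>C. \<Sum>p\<in>{p \<in> jumps A \<xi>. mv p = u}. w p * F (mv p))"
    unfolding sum_distrib_right by (intro sum.cong refl) auto
  also have "\<dots> = (\<Sum>p\<in>jumps A \<xi>. w p * F (mv p))"
    by (rule sum.group[OF fin C])
  also have "\<dots> = (\<Sum>x\<in>A. \<Sum>g\<in>{..\<xi> x} - {\<lambda>_. 0}. w (x, g) * F (mv (x, g)))"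
    unfolding jumps_def using A fb by (subst sum.Sigma) auto
  finally show ?thesis .
qed

lemma rate_right_jumps:
  "rate_right n L Q m \<xi> u = (\<Sum>p\<in>{p \<in> jumps {1..<L} \<xi>. move_right \<xi> ((\<lambda>_ _. 0)(fst p := snd p)) = u}.
     jump_rate n Q m (snd p) (\<xi> (fst p)))"
  unfolding rate_right_def jumps_def by (intro sum.cong) auto

lemma rate_left_jumps:
  "rate_left n L Q m \<eta> u = (\<Sum>p\<in>{p \<in> jumps {2..L} \<eta>. move_left \<eta> ((\<lambda>_ _. 0)(fst p := snd p)) = u}.
     jump_rate n Q m (snd p) (\<eta> (fst p)))"
  unfolding rate_left_def jumps_def by (intro sum.cong) auto

text \<open>In a single jump nothing enters the site \<open>x\<close> that loses the nonzero vector,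
  so the configuration really changes; hence omitting the starting state from the generator sum
  loses no jump.\<close>

lemma jump_right:
  assumes \<xi>: "\<xi> \<in> configs n L" and p: "p \<in> jumps {1..<L} \<xi>"
  shows "move_right \<xi> ((\<lambda>_ _. 0)(fst p := snd p)) \<in> config_class n L \<xi> - {\<xi>}"
proof -
  obtain x g where p': "p = (x, g)" "x \<in> {1..<L}" "g \<le> \<xi> x" "g \<noteq> (\<lambda>_. 0)"
    using p unfolding jumps_def by blast
  obtain i where i: "g i \<noteq> 0" using p'(4) by (auto simp: fun_eq_iff)
  have "move_right \<xi> ((\<lambda>_ _. 0)(x := g)) x i \<noteq> \<xi> x i"
    using i p'(2) le_funD[OF p'(3), of i] by (auto simp: move_right_def)
  then have "move_right \<xi> ((\<lambda>_ _. 0)(x := g)) \<noteq> \<xi>" by metis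
  moreover have "move_right \<xi> ((\<lambda>_ _. 0)(x := g)) \<in> config_class n L \<xi>"
    using p' by (intro move_right_class[OF \<xi>]) (auto simp: le_fun_def)
  ultimately show ?thesis by (simp add: p')
qed

lemma jump_left:
  assumes \<eta>: "\<eta> \<in> configs n L" and p: "p \<in> jumps {2..L} \<eta>"
  shows "move_left \<eta> ((\<lambda>_ _. 0)(fst p := snd p)) \<in> config_class n L \<eta> - {\<eta>}"
proof -
  obtain x g where p': "p = (x, g)" "x \<in> {2..L}" "g \<le> \<eta> x" "g \<noteq> (\<lambda>_. 0)"
    using p unfolding jumps_def by blast
  obtain i where i: "g i \<noteq> 0" using p'(4) by (auto simp: fun_eq_iff)
  have "move_left \<eta> ((\<lambda>_ _. 0)(x := g)) x i \<noteq> \<eta> x i"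
    using i p'(2) le_funD[OF p'(3), of i] by (auto simp: move_left_def)
  then have "move_left \<eta> ((\<lambda>_ _. 0)(x := g)) \<noteq> \<eta>" by metis
  moreover have "move_left \<eta> ((\<lambda>_ _. 0)(x := g)) \<in> config_class n L \<eta>"
    using p' by (intro move_left_class[OF \<eta>]) (auto simp: le_fun_def)
  ultimately show ?thesis by (simp add: p')
qed

lemma rate_right_0:
  assumes "\<xi> \<in> configs n L" "u \<notin> config_class n L \<xi>"
  shows "rate_right n L Q m \<xi> u = 0"
proof -
  have "{p \<in> jumps {1..<L} \<xi>. move_right \<xi> ((\<lambda>_ _. 0)(fst p := snd p)) = u} = {}"
    using jump_right[OF assms(1)] assms(2) by blast
  then show ?thesis unfolding rate_right_jumps by (simp only: sum.empty)
qed

lemma rate_left_0: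
  assumes "\<eta> \<in> configs n L" "u \<notin> config_class n L \<eta>"
  shows "rate_left n L Q m \<eta> u = 0"
proof -
  have "{p \<in> jumps {2..L} \<eta>. move_left \<eta> ((\<lambda>_ _. 0)(fst p := snd p)) = u} = {}"
    using jump_left[OF assms(1)] assms(2) by blast
  then show ?thesis unfolding rate_left_jumps by (simp only: sum.empty)
qed

text \<open>A single jump changes \<open>Dual\<close> by the factor of one bond only, the others
  being 1 by \<open>bond_0\<close>. Duality thus holds bond by bond through
  \<open>jump_bond_duality\<close>.\<close>

lemma generator_duality:
  assumes q: "0 < q" "q < 1" and L: "1 \<le> L" and m: "0 \<le> m" "m < 1"
    and \<xi>: "\<xi> \<in> configs n L" and \<eta>: "\<eta> \<in> configs n L"
  shows "(\<Sum>u\<in>config_class n L \<xi> - {\<xi>}. rate_right n L (q\<^sup>2) m \<xi> u * (Dual n L q u \<eta> - Dual n L q \<xi> \<eta>))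
     = (\<Sum>u\<in>config_class n L \<eta> - {\<eta>}. rate_left n L (q\<^sup>2) m \<eta> u * (Dual n L q \<xi> u - Dual n L q \<xi> \<eta>))"
proof -
  define Q where "Q = q\<^sup>2"
  have Q: "0 < Q" "Q < 1" using q by (simp_all add: Q_def power_less_one_iff)
  let ?z = "site_z n L q \<xi> \<eta>" and ?D = "Dual n L q \<xi> \<eta>"
  have z: "?z x j * Q ^ k \<noteq> 1" for x j k
    using bond_z_neq[OF q] by (simp add: site_z_def Q_def)
  have right: "Dual n L q (move_right \<xi> ((\<lambda>_ _. 0)(x := g))) \<eta> = ?D * bond n Q (?z x) g (\<eta> (x + 1))"
    if "x \<in> {1..<L}" "g \<in> {..\<xi> x} - {\<lambda>_. 0}" for x g
  proof -
    have "Dual n L q (move_right \<xi> ((\<lambda>_ _. 0)(x := g))) \<eta>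
       = ?D * (\<Prod>y\<in>{1..<L}. bond n Q (?z y) (((\<lambda>_ _. 0)(x := g)) y) (\<eta> (y + 1)))"
      unfolding Q_def using that by (intro Dual_move_right[OF q L]) (auto simp: le_fun_def)
    also have "(\<Prod>y\<in>{1..<L}. bond n Q (?z y) (((\<lambda>_ _. 0)(x := g)) y) (\<eta> (y + 1)))
       = (\<Prod>y\<in>{1..<L}. if y = x then bond n Q (?z x) g (\<eta> (x + 1)) else 1)"
      by (intro prod.cong refl) (auto simp: bond_0[OF z])
    also have "\<dots> = bond n Q (?z x) g (\<eta> (x + 1))" using that by simp
    finally show ?thesis .
  qed
  have left: "Dual n L q \<xi> (move_left \<eta> ((\<lambda>_ _. 0)(x := g))) = ?D * bond n Q (?z (x - 1)) (\<xi> (x - 1)) g"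
    if "x \<in> {2..L}" "g \<in> {..\<eta> x} - {\<lambda>_. 0}" for x g
  proof -
    have "Dual n L q \<xi> (move_left \<eta> ((\<lambda>_ _. 0)(x := g)))
       = ?D * (\<Prod>y\<in>{1..<L}. bond n Q (?z y) (\<xi> y) (((\<lambda>_ _. 0)(x := g)) (y + 1)))"
      unfolding Q_def using that by (intro Dual_move_left[OF q L]) (auto simp: le_fun_def)
    also have "(\<Prod>y\<in>{1..<L}. bond n Q (?z y) (\<xi> y) (((\<lambda>_ _. 0)(x := g)) (y + 1)))
       = (\<Prod>y\<in>{1..<L}. if y = x - 1 then bond n Q (?z (x - 1)) (\<xi> (x - 1)) g else 1)"
      using that by (intro prod.cong refl) (auto simp: bond_0[OF z])
    also have "\<dots> = bond n Q (?z (x - 1)) (\<xi> (x - 1)) g" using that by auto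
    finally show ?thesis .
  qed
  have "(\<Sum>u\<in>config_class n L \<xi> - {\<xi>}. rate_right n L Q m \<xi> u * (Dual n L q u \<eta> - ?D))
     = (\<Sum>x\<in>{1..<L}. \<Sum>g\<in>{..\<xi> x} - {\<lambda>_. 0}. jump_rate n Q m g (\<xi> x)
         * (Dual n L q (move_right \<xi> ((\<lambda>_ _. 0)(x := g))) \<eta> - ?D))"
    unfolding rate_right_jumps using finite_config_class jump_right[OF \<xi>]
    by (subst sum_jumps_group[OF _ \<xi>]) auto
  also have "\<dots> = (\<Sum>x\<in>{1..<L}. \<Sum>g\<in>{..\<xi> x} - {\<lambda>_. 0}. ?D * (jump_rate n Q m g (\<xi> x)
         * (bond n Q (?z x) g (\<eta> (x + 1)) - 1)))"
    by (intro sum.cong refl, subst right) (auto simp: algebra_simps)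
  also have "\<dots> = (\<Sum>x\<in>{1..<L}. \<Sum>g\<in>{..\<eta> (x + 1)} - {\<lambda>_. 0}. ?D * (jump_rate n Q m g (\<eta> (x + 1))
         * (bond n Q (?z x) (\<xi> x) g - 1)))"
    unfolding sum_distrib_left[symmetric]
    by (simp only: jump_bond_duality[OF Q m z configs_vecs[OF \<xi>] configs_vecs[OF \<eta>]])
  also have "\<dots> = (\<Sum>x\<in>{2..L}. \<Sum>g\<in>{..\<eta> x} - {\<lambda>_. 0}. ?D * (jump_rate n Q m g (\<eta> x)
         * (bond n Q (?z (x - 1)) (\<xi> (x - 1)) g - 1)))"
    by (rule sum.reindex_bij_witness[of _ "\<lambda>x. x - 1" "\<lambda>x. x + 1"]) auto
  also have "\<dots> = (\<Sum>x\<in>{2..L}. \<Sum>g\<in>{..\<eta> x} - {\<lambda>_. 0}. jump_rate n Q m g (\<eta> x)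
         * (Dual n L q \<xi> (move_left \<eta> ((\<lambda>_ _. 0)(x := g))) - ?D))"
    by (intro sum.cong refl, subst left) (auto simp: algebra_simps)
  also have "\<dots> = (\<Sum>u\<in>config_class n L \<eta> - {\<eta>}. rate_left n L Q m \<eta> u * (Dual n L q \<xi> u - ?D))"
    unfolding rate_left_jumps using finite_config_class jump_left[OF \<eta>]
    by (subst sum_jumps_group[OF _ \<eta>]) auto
  finally show ?thesis by (simp only: Q_def)
qed

lemma continuous_duality:
  assumes q: "0 < q" "q < 1" and L: "1 \<le> L" and m: "0 \<le> m" "m < 1"
    and P: "markov_jump_law (configs n L) (rate_right n L (q\<^sup>2) m) P"
    and P': "markov_jump_law (configs n L) (rate_left n L (q\<^sup>2) m) P'"
    and t: "0 \<le> t" and \<xi>: "\<xi> \<in> configs n L" and \<eta>: "\<eta> \<in> configs n L"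
  shows "measure_pmf.expectation (P t \<xi>) (\<lambda>\<xi>'. Dual n L q \<xi>' \<eta>)
       = measure_pmf.expectation (P' t \<eta>) (Dual n L q \<xi>)"
proof (rule markov_jump_law_duality[OF P P', where C = "config_class n L \<xi>" and C' = "config_class n L \<eta>"])
  fix s u assume s: "s \<in> config_class n L \<xi>" and u: "u \<in> configs n L - config_class n L \<xi>"
  \<comment> \<open>The class is the same for each of its members, so leaving the class of the
    starting configuration means leaving that of \<open>s\<close>.\<close>
  then have "s \<in> configs n L" "u \<notin> config_class n L s"
    using config_class_subset config_class_eq[OF s] by auto
  then show "rate_right n L (q\<^sup>2) m s u = 0" by (rule rate_right_0)
next
  fix s u assume s: "s \<in> config_class n L \<eta>" and u: "u \<in> configs n L - config_class n L \<eta>"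
  then have "s \<in> configs n L" "u \<notin> config_class n L s"
    using config_class_subset config_class_eq[OF s] by auto
  then show "rate_left n L (q\<^sup>2) m s u = 0" by (rule rate_left_0)
next
  fix s s' assume s: "s \<in> config_class n L \<xi>" and s': "s' \<in> config_class n L \<eta>"
  then have "s \<in> configs n L" "s' \<in> configs n L" using config_class_subset by auto
  from generator_duality[OF q L m this]
  show "(\<Sum>u\<in>config_class n L \<xi> - {s}. rate_right n L (q\<^sup>2) m s u * (Dual n L q u s' - Dual n L q s s'))
     = (\<Sum>u\<in>config_class n L \<eta> - {s'}. rate_left n L (q\<^sup>2) m s' u * (Dual n L q s u - Dual n L q s s'))"
    unfolding config_class_eq[OF s] config_class_eq[OF s'] .
qed (use \<xi> \<eta> t in \<open>auto simp: finite_config_class config_class_self config_class_subset\<close>)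

theorem theorem3p4:
  fixes q m :: real and n L :: nat
  assumes "0 < q" and "q < 1" and "n \<ge> 1" and "L \<ge> 1" and "0 \<le> m" and "m < 1"
  shows
    "(\<forall>l. 0 < l \<and> m \<le> l \<and> l \<le> 1 \<longrightarrow>
        (\<forall>t. \<forall>\<xi>\<in>configs n L. \<forall>\<eta>\<in>configs n L.
           measure_pmf.expectation (chain_law (step_right n L (q\<^sup>2) l m) t \<xi>)
             (\<lambda>\<xi>'. Dual n L q \<xi>' \<eta>)
         = measure_pmf.expectation (chain_law (step_left n L (q\<^sup>2) l m) t \<eta>)
             (\<lambda>\<eta>'. Dual n L q \<xi> \<eta>')))
   \<and> (\<forall>P P'. markov_jump_law (configs n L) (rate_right n L (q\<^sup>2) m) P \<and>
             markov_jump_law (configs n L) (rate_left n L (q\<^sup>2) m) P' \<longrightarrow>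
        (\<forall>t\<ge>0. \<forall>\<xi>\<in>configs n L. \<forall>\<eta>\<in>configs n L.
           measure_pmf.expectation (P t \<xi>) (\<lambda>\<xi>'. Dual n L q \<xi>' \<eta>)
         = measure_pmf.expectation (P' t \<eta>) (\<lambda>\<eta>'. Dual n L q \<xi> \<eta>')))"
  using discrete_duality[OF assms(1,2,4) _ assms(5) _ _ assms(6)]
    continuous_duality[OF assms(1,2,4,5,6)] by blast

end
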